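(* Let $X$ be a centred and isotropic random vector in $\mathbb{R}^d$ with law $\mu$. If either (A1) $\sup_{\theta\in S^{d-1}}\|\langle X,\theta\rangle\|_{L_4}\le L$ for some $L\ge1$, or (A2) $X$ is log-concave, then there is a constant $c_1$ that depends only on $L$ and an absolute constant $c_2$ such that $$\sup_{\theta\in S^{d-1}}\left(\frac1m\sum_{i=1}^m\left(\langle X_i,\theta\rangle^\sharp-\lambda_i^\theta\right)^2\right)^{1/2}\ge\mathcal{SW}_2(\mu_m,\mu)-\begin{cases}c_1/m^{1/4}&\text{if (A1) holds},\\ c_2\log(m)/\sqrt m&\text{if (A2) holds}.\end{cases}$$
   Context: Isotropic means the covariance is the identity. A random vector is log-concave if it has a density that is a log-concave function. $S^{d-1}$ is the Euclidean unit sphere in $\mathbb{R}^d$. $X_1,\dots,X_m$ are independent copies of $X$ and $\mu_m=\frac1m\sum_{i=1}^m\delta_{X_i}$ is the empirical measure. For a probability measure $\nu$ on $\mathbb{R}^d$ and $\theta\in S^{d-1}$, $\nu^\theta$ is the push-forward of $\nu$ under $x\mapsto\langle x,\theta\rangle$. $F_{\mu^\theta}(t)=\mu^\theta((-\infty,t])$, $F_{\mu^\theta}^{-1}(u)=\inf\{t\in\mathbb{R}:F_{\mu^\theta}(t)\ge u\}$, and $\lambda_i^\theta=m\int_{(i-1)/m}^{i/m}F_{\mu^\theta}^{-1}(u)\,du$ for $1\le i\le m$. $\langle X_i,\theta\rangle^\sharp$ is the $i$-th entry of the monotone non-decreasing rearrangement of $(\langle X_j,\theta\rangle)_{j=1}^m$.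 For probability measures $\tau,\nu$ with finite second moment, $\mathcal{W}_2(\tau,\nu)=\inf_\Pi\left(\int\|x-y\|_2^2\,\Pi(dx,dy)\right)^{1/2}$, the infimum being over all couplings $\Pi$ of $\tau$ and $\nu$, and $\mathcal{SW}_2(\mu,\nu)=\sup_{\theta\in S^{d-1}}\mathcal{W}_2(\mu^\theta,\nu^\theta)$.
   Formalization: Case (A2) is stated for m ≥ 2: for m = 1, log(m) = 0 and the claim fails, as |X_1| < sqrt(|X_1|²+1) = SW_2. The sample space is any probability space on sequences of real sequences; other spaces reduce to it, since only the law of X and the values of the X_i matter. *)

theory Defs
  imports "HOL-Probability.Probability"
begin

text \<open>
  The constants of the theorem must not depend on the dimension, so the dimension \<open>d\<close> is a
  natural number that can be quantified below them: \<open>\<real>\<^sup>d\<close> is the set of functions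
  \<^term>\<open>{..<d} \<rightarrow>\<^sub>E (UNIV :: real set)\<close>, with its product Borel sigma-algebra.
\<close>

definition Rd :: "nat \<Rightarrow> (nat \<Rightarrow> real) measure" where
  "Rd d = PiM {..<d} (\<lambda>_. borel)"

definition leb :: "nat \<Rightarrow> (nat \<Rightarrow> real) measure" where
  "leb d = PiM {..<d} (\<lambda>_. lborel)"

definition ip :: "nat \<Rightarrow> (nat \<Rightarrow> real) \<Rightarrow> (nat \<Rightarrow> real) \<Rightarrow> real" where
  "ip d x y = (\<Sum>k<d. x k * y k)"

definition unit_sphere :: "nat \<Rightarrow> (nat \<Rightarrow> real) set" where
  "unit_sphere d = {\<theta> \<in> {..<d} \<rightarrow>\<^sub>E UNIV. sqrt (ip d \<theta> \<theta>) = 1}"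

definition centred :: "nat \<Rightarrow> 'w measure \<Rightarrow> ('w \<Rightarrow> nat \<Rightarrow> real) \<Rightarrow> bool" where
  "centred d M X \<longleftrightarrow>
     (\<forall>k<d. integrable M (\<lambda>\<omega>. X \<omega> k) \<and> (\<integral>\<omega>. X \<omega> k \<partial>M) = 0)"

definition covariance :: "'w measure \<Rightarrow> ('w \<Rightarrow> real) \<Rightarrow> ('w \<Rightarrow> real) \<Rightarrow> real" where
  "covariance M Y Z = (\<integral>\<omega>. (Y \<omega> - (\<integral>\<omega>'. Y \<omega>' \<partial>M)) * (Z \<omega> - (\<integral>\<omega>'. Z \<omega>' \<partial>M)) \<partial>M)"

definition isotropic :: "nat \<Rightarrow> 'w measure \<Rightarrow> ('w \<Rightarrow> nat \<Rightarrow> real) \<Rightarrow> bool" where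
  "isotropic d M X \<longleftrightarrow>
     (\<forall>k<d. integrable M (\<lambda>\<omega>. (X \<omega> k)\<^sup>2)) \<and>
     (\<forall>j<d. \<forall>k<d. covariance M (\<lambda>\<omega>. X \<omega> j) (\<lambda>\<omega>. X \<omega> k) = (if j = k then 1 else 0))"

definition L4_norm :: "'w measure \<Rightarrow> ('w \<Rightarrow> real) \<Rightarrow> ennreal" where
  "L4_norm M Y =
     (if integrable M (\<lambda>\<omega>. \<bar>Y \<omega>\<bar> ^ 4) then ennreal (root 4 (\<integral>\<omega>. \<bar>Y \<omega>\<bar> ^ 4 \<partial>M)) else \<infinity>)"

text \<open>
  Concavity of \<open>log f\<close> as a function into \<open>[-\<infinity>, \<infinity>)\<close>, in exponentiated form. As
  \<^term>\<open>(0::real) powr a = 0\<close>, the condition is void where \<open>f\<close> vanishes at \<open>x\<close> or \<open>y\<close>.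
\<close>

definition log_concave_fun :: "nat \<Rightarrow> ((nat \<Rightarrow> real) \<Rightarrow> real) \<Rightarrow> bool" where
  "log_concave_fun d f \<longleftrightarrow>
     (\<forall>x \<in> {..<d} \<rightarrow>\<^sub>E UNIV. 0 \<le> f x) \<and>
     (\<forall>x \<in> {..<d} \<rightarrow>\<^sub>E UNIV. \<forall>y \<in> {..<d} \<rightarrow>\<^sub>E UNIV. \<forall>t \<in> {0<..<1}.
        f x powr (1 - t) * f y powr t \<le> f (\<lambda>k\<in>{..<d}. (1 - t) * x k + t * y k))"

definition log_concave :: "nat \<Rightarrow> 'w measure \<Rightarrow> ('w \<Rightarrow> nat \<Rightarrow> real) \<Rightarrow> bool" where
  "log_concave d M X \<longleftrightarrow>
     (\<exists>f. log_concave_fun d f \<and> distributed M (leb d) X (\<lambda>x. ennreal (f x)))"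

definition iid_copies ::
  "nat \<Rightarrow> nat \<Rightarrow> 'w measure \<Rightarrow> ('w \<Rightarrow> nat \<Rightarrow> real) \<Rightarrow> (nat \<Rightarrow> 'w \<Rightarrow> nat \<Rightarrow> real) \<Rightarrow> bool" where
  "iid_copies d m M X Xs \<longleftrightarrow>
     prob_space.indep_vars M (\<lambda>_. Rd d) Xs {1..m} \<and>
     (\<forall>i\<in>{1..m}. distr M (Rd d) (Xs i) = distr M (Rd d) X)"

definition empirical :: "nat \<Rightarrow> nat \<Rightarrow> (nat \<Rightarrow> nat \<Rightarrow> real) \<Rightarrow> (nat \<Rightarrow> real) measure" where
  "empirical d m x = measure_of (space (Rd d)) (sets (Rd d))
     (\<lambda>A. ennreal (1 / real m) * (\<Sum>i=1..m. emeasure (return (Rd d) (x i)) A))"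

definition marginal :: "nat \<Rightarrow> (nat \<Rightarrow> real) measure \<Rightarrow> (nat \<Rightarrow> real) \<Rightarrow> real measure" where
  "marginal d \<nu> \<theta> = distr \<nu> borel (\<lambda>x. ip d x \<theta>)"

definition quantile :: "real measure \<Rightarrow> real \<Rightarrow> real" where
  "quantile \<nu> u = Inf {t. cdf \<nu> t \<ge> u}"

definition lam :: "nat \<Rightarrow> nat \<Rightarrow> (nat \<Rightarrow> real) measure \<Rightarrow> (nat \<Rightarrow> real) \<Rightarrow> nat \<Rightarrow> real" where
  "lam d m \<mu> \<theta> i =
     real m * (LBINT u:{(real i - 1) / real m..real i / real m}. quantile (marginal d \<mu> \<theta>) u)"

definition rearr :: "nat \<Rightarrow> (nat \<Rightarrow> real) \<Rightarrow> nat \<Rightarrow> real" where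
  "rearr m a i = sort (map a [1..<Suc m]) ! (i - 1)"

definition couplings :: "'a::euclidean_space measure \<Rightarrow> 'a measure \<Rightarrow> ('a \<times> 'a) measure set" where
  "couplings \<tau> \<nu> =
     {P. sets P = sets (borel \<Otimes>\<^sub>M borel) \<and> distr P borel fst = \<tau> \<and> distr P borel snd = \<nu>}"

text \<open>
  Meant for Borel probability measures with finite second moment. Then the set of couplings is
  not empty and the integrand is integrable with respect to each of them.
\<close>

definition W2 :: "'a::euclidean_space measure \<Rightarrow> 'a measure \<Rightarrow> real" where
  "W2 \<tau> \<nu> = (INF P \<in> couplings \<tau> \<nu>. sqrt (\<integral>z. (norm (fst z - snd z))\<^sup>2 \<partial>P))"

definition SW2 :: "nat \<Rightarrow> (nat \<Rightarrow> real) measure \<Rightarrow> (nat \<Rightarrow> real) measure \<Rightarrow> real" where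
  "SW2 d \<mu> \<nu> = (SUP \<theta> \<in> unit_sphere d. W2 (marginal d \<mu> \<theta>) (marginal d \<nu> \<theta>))"

text \<open>The left-hand side of the inequality, for the sample points \<open>x 1, \<dots>, x m\<close>.\<close>

definition deviation :: "nat \<Rightarrow> nat \<Rightarrow> (nat \<Rightarrow> real) measure \<Rightarrow> (nat \<Rightarrow> nat \<Rightarrow> real) \<Rightarrow> real" where
  "deviation d m \<mu> x = (SUP \<theta> \<in> unit_sphere d.
     sqrt (1 / real m * (\<Sum>i=1..m. (rearr m (\<lambda>j. ip d (x j) \<theta>) i - lam d m \<mu> \<theta> i)\<^sup>2)))"

text \<open>
  The underlying type of the probability spaces. A type variable could only be quantified outside
  the theorem, so that the constants might depend on it. On this type every joint
  law of \<open>X, X\<^sub>1, \<dots>, X\<^sub>m\<close> is realised by the coordinate maps \<open>\<omega> 0, \<dots>, \<omega> m\<close>, and the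
  assertion only involves that law and the values of \<open>X\<^sub>1, \<dots>, X\<^sub>m\<close>.
\<close>

type_synonym outcome = "nat \<Rightarrow> nat \<Rightarrow> real"

end

theory Submission
  imports Defs
begin

text \<open>
  In a fixed direction \<open>\<theta>\<close> everything happens on the unit interval. Let \<open>q\<close> be the quantile
  function of the marginal law and \<open>T\<close> the step function with value
  \<open>\<langle>X\<^sub>i, \<theta>\<rangle>\<^sup>\<sharp>\<close> on the cell \<open>((i - 1)/m, i/m]\<close>. Under the uniform law on \<open>(0, 1)\<close> the pair
  \<open>(T, q)\<close> is a coupling of the empirical marginal and the true one, so the squared Wasserstein
  distance is at most \<open>\<integral>(T - q)\<^sup>2\<close>. As \<open>\<lambda>\<^sub>i\<close> is the mean of \<open>q\<close> over its cell, Pythagoras gives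
  \<open>\<integral>(T - q)\<^sup>2 = (1/m) \<Sum>\<^sub>i (T\<^sub>i - \<lambda>\<^sub>i)\<^sup>2 + R\<close>, where the residual \<open>R\<close> is the squared \<open>L\<^sub>2\<close> distance
  from \<open>q\<close> to its cell means (\<open>step_distance\<close>). Since \<open>sqrt (a + b) \<le> sqrt a + sqrt b\<close>,
  it remains to bound \<open>R\<close>, which depends on the law of \<open>X\<close> only, uniformly in \<open>\<theta>\<close>.

  On the inner cells \<open>R\<close> is controlled by monotonicity: the oscillations \<open>D\<^sub>i\<close> of \<open>q\<close> telescope,
  hence \<open>\<Sum> D\<^sub>i\<^sup>2 \<le> (\<Sum> D\<^sub>i)\<^sup>2\<close> is at most \<open>4 B\<^sup>2\<close> if \<open>\<bar>q\<bar> \<le> B\<close> on \<open>[1/m, 1 - 1/m]\<close>. On the two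
  extreme cells \<open>R\<close> is at most \<open>\<integral> q\<^sup>2\<close> (\<open>residual_le\<close>). If the fourth moment is at most \<open>L\<^sup>4\<close>, then
  \<open>B = L m\<^bsup>1/4\<^esup>\<close> works and both contributions are of order \<open>L\<^sup>2/\<surd>m\<close>
  (\<open>fourth_moment_residual\<close>). If the marginal has tails \<open>exp (1 - t/3)\<close>, then
  \<open>B = 3 + 3 ln m\<close> works and both contributions are of order \<open>(ln m)\<^sup>2/m\<close>
  (\<open>exponential_tail_residual\<close>).

  The exponential tail of a log-concave vector comes from the inequality
  \<open>G s * G t \<le> (G ((s + t)/2))\<^sup>2\<close> for the half-space probabilities \<open>G t = P(\<langle>X, \<theta>\<rangle> > t)\<close>. This is the
  midpoint case of the Prekopa-Leindler inequality; squaring it keeps the statement inside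
  \<open>[0, \<infinity>]\<close>, so that it can be proved by induction on the dimension with Fubini's theorem
  (\<open>prekopa_leindler_midpoint\<close>). Chebyshev's inequality bounds \<open>G (-3)\<close> from below and \<open>G 3\<close>
  from above, and log-concavity propagates the resulting drop geometrically.
\<close>

section \<open>The Brunn-Minkowski inequality on the line\<close>

text \<open>
  For \<open>a \<in> A\<close> and \<open>b \<in> B\<close>, the translates of \<open>A \<inter> {..a}\<close> by \<open>b\<close> and of \<open>B \<inter> {b..}\<close> by \<open>a\<close> lie in
  \<open>2 C\<close> on either side of \<open>a + b\<close>, hence their measures add up. Taking \<open>a\<close> close to the supremum of
  \<open>A\<close> and \<open>b\<close> close to the infimum of \<open>B\<close> loses arbitrarily little measure.
\<close>
lemma brunn_minkowski_bounded:
  fixes A B C :: "real set"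
  assumes [measurable]: "A \<in> sets borel" "B \<in> sets borel" "C \<in> sets borel"
    and ne: "A \<noteq> {}" "B \<noteq> {}" and bdd: "bdd_above A" "bdd_below B"
    and mid: "\<And>x y. x \<in> A \<Longrightarrow> y \<in> B \<Longrightarrow> (x + y) / 2 \<in> C"
  shows "emeasure lborel A + emeasure lborel B \<le> 2 * emeasure lborel C"
proof (rule ennreal_le_epsilon)
  fix e :: real assume e: "0 < e"
  obtain a where a: "a \<in> A" "Sup A - e / 2 < a"
    using less_cSupE[OF _ ne(1), of "Sup A - e/2"] e by auto
  obtain b where b: "b \<in> B" "b < Inf B + e / 2"
    using cInf_lessD[OF ne(2), of "Inf B + e/2"] e by auto
  define c where "c = (a + b) / 2"
  have halve: "emeasure lborel D \<le> 2 * emeasure lborel S"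
    if [measurable]: "D \<in> sets borel" "S \<in> sets borel"
      and sub: "\<And>x. x \<in> D \<Longrightarrow> p / 2 + x / 2 \<in> S" for D S and p :: real
  proof -
    have "emeasure lborel D = (\<integral>\<^sup>+x. indicator D x \<partial>lborel)" by simp
    also have "\<dots> \<le> (\<integral>\<^sup>+x. indicator S (p / 2 + (1/2) * x) \<partial>lborel)"
      by (intro nn_integral_mono) (use sub in \<open>auto split: split_indicator\<close>)
    finally have le: "emeasure lborel D \<le> (\<integral>\<^sup>+x. indicator S (p / 2 + (1/2) * x) \<partial>lborel)" .
    have "emeasure lborel S = (\<integral>\<^sup>+x. indicator S x \<partial>lborel)" by simp
    also have "\<dots> = ennreal \<bar>1/2\<bar> * (\<integral>\<^sup>+x. indicator S (p / 2 + (1/2) * x) \<partial>lborel)"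
      by (rule nn_integral_real_affine) auto
    finally have "2 * emeasure lborel S =
        (2 * ennreal (1/2)) * (\<integral>\<^sup>+x. indicator S (p / 2 + (1/2) * x) \<partial>lborel)"
      by (simp add: mult.assoc)
    also have "2 * ennreal (1/2) = 1"
      by (metis ennreal_1 ennreal_mult' ennreal_numeral nonzero_mult_div_cancel_left
          times_divide_eq_right zero_le_numeral zero_neq_numeral mult.right_neutral)
    finally show ?thesis using le by simp
  qed
  have "emeasure lborel (A \<inter> {..a}) \<le> 2 * emeasure lborel (C \<inter> {..c})"
    by (rule halve[of _ _ b]) (use mid b in \<open>auto simp: c_def field_simps\<close>)
  moreover have "emeasure lborel (B \<inter> {b..}) \<le> 2 * emeasure lborel (C \<inter> {c..})"
    by (rule halve[of _ _ a]) (use mid[OF a(1)] in \<open>auto simp: c_def add_divide_distrib\<close>)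
  moreover have "emeasure lborel (C \<inter> {..c}) + emeasure lborel (C \<inter> {c..}) = emeasure lborel C"
  proof -
    have "emeasure lborel (C \<inter> {c..}) = emeasure lborel (C \<inter> {c<..})"
      using AE_lborel_singleton[of c] by (intro emeasure_eq_AE) auto
    moreover have "emeasure lborel (C \<inter> {..c}) + emeasure lborel (C \<inter> {c<..})
        = emeasure lborel ((C \<inter> {..c}) \<union> (C \<inter> {c<..}))"
      by (intro plus_emeasure) auto
    moreover have "(C \<inter> {..c}) \<union> (C \<inter> {c<..}) = C" by auto
    ultimately show ?thesis by simp
  qed
  ultimately have main: "emeasure lborel (A \<inter> {..a}) + emeasure lborel (B \<inter> {b..})
      \<le> 2 * emeasure lborel C"
    by (metis add_mono distrib_left)
  have "emeasure lborel A \<le> emeasure lborel ((A \<inter> {..a}) \<union> {a..Sup A})"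
    by (intro emeasure_mono) (use bdd in \<open>auto intro: cSup_upper\<close>)
  also have "\<dots> \<le> emeasure lborel (A \<inter> {..a}) + emeasure lborel {a..Sup A}"
    by (intro emeasure_subadditive) auto
  also have "emeasure lborel {a..Sup A} \<le> ennreal (e / 2)"
    using a cSup_upper[OF a(1) bdd(1)] by (auto intro!: ennreal_leI)
  finally have A: "emeasure lborel A \<le> emeasure lborel (A \<inter> {..a}) + ennreal (e/2)"
    by (simp add: add_left_mono)
  have "emeasure lborel B \<le> emeasure lborel ((B \<inter> {b..}) \<union> {Inf B..b})"
    by (intro emeasure_mono) (use bdd in \<open>auto intro: cInf_lower\<close>)
  also have "\<dots> \<le> emeasure lborel (B \<inter> {b..}) + emeasure lborel {Inf B..b}"
    by (intro emeasure_subadditive) auto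
  also have "emeasure lborel {Inf B..b} \<le> ennreal (e / 2)"
    using b cInf_lower[OF b(1) bdd(2)] by (auto intro!: ennreal_leI)
  finally have B: "emeasure lborel B \<le> emeasure lborel (B \<inter> {b..}) + ennreal (e/2)"
    by (simp add: add_left_mono)
  have "emeasure lborel A + emeasure lborel B
      \<le> (emeasure lborel (A \<inter> {..a}) + emeasure lborel (B \<inter> {b..})) + (ennreal (e/2) + ennreal (e/2))"
    using add_mono[OF A B] by (simp add: ac_simps)
  also have "ennreal (e/2) + ennreal (e/2) = ennreal e"
    using e by (subst ennreal_plus[symmetric]) auto
  finally show "emeasure lborel A + emeasure lborel B \<le> 2 * emeasure lborel C + ennreal e"
    using main by (meson add_right_mono order_trans)
qed

lemma brunn_minkowski_real:
  fixes A B C :: "real set"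
  assumes [measurable]: "A \<in> sets borel" "B \<in> sets borel" "C \<in> sets borel"
    and ne: "A \<noteq> {}" "B \<noteq> {}"
    and mid: "\<And>x y. x \<in> A \<Longrightarrow> y \<in> B \<Longrightarrow> (x + y) / 2 \<in> C"
  shows "emeasure lborel A + emeasure lborel B \<le> 2 * emeasure lborel C"
proof -
  let ?w = "\<lambda>n::nat. {- real n..real n}"
  have exh: "(\<Union>n. S \<inter> ?w n) = S" for S :: "real set"
  proof -
    have "x \<in> (\<Union>n. ?w n)" for x :: real
      using real_arch_simple[of "\<bar>x\<bar>"] by (auto simp: abs_le_iff minus_le_iff)
    then show ?thesis by auto
  qed
  have inc: "incseq (\<lambda>n. S \<inter> ?w n)" for S :: "real set"
    by (intro monoI Int_mono) auto
  have lim: "(\<lambda>n. emeasure lborel (S \<inter> ?w n)) \<longlonglongrightarrow> emeasure lborel S"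
    if [measurable]: "S \<in> sets borel" for S
  proof -
    have "range (\<lambda>n. S \<inter> ?w n) \<subseteq> sets lborel" by auto
    from Lim_emeasure_incseq[OF this inc] show ?thesis by (simp only: exh)
  qed
  have "\<exists>n. S \<inter> ?w n \<noteq> {}" if S: "S \<noteq> {}" for S
  proof -
    from S obtain x where "x \<in> S" by blast
    then have "x \<in> (\<Union>n. S \<inter> ?w n)" by (simp only: exh)
    then show ?thesis by blast
  qed
  then obtain i j where ij: "A \<inter> ?w i \<noteq> {}" "B \<inter> ?w j \<noteq> {}" using ne by metis
  have "emeasure lborel (A \<inter> ?w n) + emeasure lborel (B \<inter> ?w n) \<le> 2 * emeasure lborel C"
    if "n \<ge> max i j" for n
  proof (rule brunn_minkowski_bounded)
    have "?w i \<subseteq> ?w n" "?w j \<subseteq> ?w n" using that by auto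
    then show "A \<inter> ?w n \<noteq> {}" "B \<inter> ?w n \<noteq> {}" using ij by blast+
  qed (use mid in \<open>auto intro: bdd_above_Int2 bdd_below_Int2\<close>)
  then have "\<exists>N. \<forall>n\<ge>N. emeasure lborel (A \<inter> ?w n) + emeasure lborel (B \<inter> ?w n) \<le> 2 * emeasure lborel C"
    by blast
  then show ?thesis
    by (rule LIMSEQ_le_const2[OF tendsto_add[OF lim[OF assms(1)] lim[OF assms(2)]]])
qed

section \<open>The Prekopa-Leindler inequality at midpoints\<close>

lemma ennreal_four_mult_le: "4 * (a * b) \<le> (a + b)\<^sup>2" for a b :: ennreal
proof (cases "a = \<infinity> \<or> b = \<infinity>")
  case False
  then obtain x y where "a = ennreal x" "b = ennreal y" "0 \<le> x" "0 \<le> y"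
    by (metis ennreal_cases infinity_ennreal_def)
  moreover have "4 * (x * y) \<le> (x + y)\<^sup>2" for x y :: real
    using zero_le_power2[of "x - y"] by (simp add: power2_eq_square algebra_simps)
  ultimately show ?thesis
    by (simp add: ennreal_mult[symmetric] ennreal_plus[symmetric] ennreal_power
        ennreal_numeral[symmetric] del: ennreal_plus ennreal_numeral)
qed (auto simp: power2_eq_square ennreal_mult_top ennreal_top_mult)

text \<open>Only the levels below 1 are integrated: at these levels, for functions with supremum 1,
  both superlevel sets are nonempty, as the Brunn-Minkowski inequality requires.\<close>
lemma nn_integral_levels:
  fixes v :: ennreal
  shows "(\<integral>\<^sup>+t. indicator {0<..<1} t * indicator {t. ennreal t < v} t \<partial>lborel) = min 1 v"
proof -
  have "{0<..<1} \<inter> {t. ennreal t < v} = {0<..<enn2real (min 1 v)}"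
  proof (cases "v < 1")
    case True
    then obtain r where "v = ennreal r" "0 \<le> r" "r < 1"
      by (cases v) (auto simp: ennreal_less_one_iff)
    then show ?thesis using True by (auto simp: ennreal_less_iff min_absorb2)
  next
    case False
    have "ennreal t < v" if "t < 1" for t
      using that False by (metis ennreal_less_one_iff less_le_trans not_less)
    then show ?thesis using False by (auto simp: min_absorb1)
  qed
  then have "(\<integral>\<^sup>+t. indicator {0<..<1} t * indicator {t. ennreal t < v} t \<partial>lborel)
      = (\<integral>\<^sup>+t. indicator {0<..<enn2real (min 1 v)} t \<partial>lborel)"
    by (intro nn_integral_cong) (simp add: indicator_inter_arith[symmetric])
  also have "\<dots> = ennreal (enn2real (min 1 v))"
    by (subst nn_integral_indicator) auto
  also have "\<dots> = min 1 v" by (rule ennreal_enn2real) (auto simp: min_less_iff_disj)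
  finally show ?thesis .
qed

lemma layer_cake:
  fixes f :: "real \<Rightarrow> ennreal"
  assumes [measurable]: "f \<in> borel_measurable borel"
  shows "(\<integral>\<^sup>+x. min 1 (f x) \<partial>lborel)
    = (\<integral>\<^sup>+t. indicator {0<..<1} t * emeasure lborel {x. ennreal t < f x} \<partial>lborel)"
proof -
  have "(\<integral>\<^sup>+x. min 1 (f x) \<partial>lborel)
      = (\<integral>\<^sup>+x. (\<integral>\<^sup>+t. indicator {0<..<1} t * indicator {x. ennreal t < f x} x \<partial>lborel) \<partial>lborel)"
    using nn_integral_levels by (simp add: indicator_def)
  also have "\<dots> = (\<integral>\<^sup>+t. (\<integral>\<^sup>+x. indicator {0<..<1} t * indicator {x. ennreal t < f x} x \<partial>lborel) \<partial>lborel)"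
    by (rule lborel_pair.Fubini') measurable
  also have "\<dots> = (\<integral>\<^sup>+t. indicator {0<..<1} t * emeasure lborel {x. ennreal t < f x} \<partial>lborel)"
    by (intro nn_integral_cong) (subst nn_integral_cmult, auto)
  finally show ?thesis .
qed

text \<open>
  If \<open>f\<close> and \<open>g\<close> both have supremum 1, midpoints of their superlevel sets at a common level lie in
  the superlevel set of \<open>h\<close>. Integrating the Brunn-Minkowski inequality over the levels gives the
  arithmetic form \<open>\<integral>f + \<integral>g \<le> 2 \<integral>h\<close>, which is stronger than the geometric one.
\<close>
lemma prekopa_leindler_normalized:
  fixes f g h :: "real \<Rightarrow> ennreal"
  assumes [measurable]: "f \<in> borel_measurable borel" "g \<in> borel_measurable borel" "h \<in> borel_measurable borel"
    and f1: "\<And>x. f x \<le> 1" and g1: "\<And>x. g x \<le> 1"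
    and fs: "\<And>t. t < 1 \<Longrightarrow> \<exists>x. t < f x" and gs: "\<And>t. t < 1 \<Longrightarrow> \<exists>x. t < g x"
    and fgh: "\<And>x y. f x * g y \<le> (h ((x + y) / 2))\<^sup>2"
  shows "(\<integral>\<^sup>+x. f x \<partial>lborel) * (\<integral>\<^sup>+x. g x \<partial>lborel) \<le> (\<integral>\<^sup>+x. h x \<partial>lborel)\<^sup>2"
proof -
  let ?lev = "\<lambda>f t. emeasure lborel {x. ennreal t < f x}"
  have bm: "?lev f t + ?lev g t \<le> 2 * ?lev h t" if t: "0 < t" "t < 1" for t
  proof (rule brunn_minkowski_real)
    fix x y assume "x \<in> {x. ennreal t < f x}" "y \<in> {x. ennreal t < g x}"
    then have "ennreal t * ennreal t < ennreal t * g y" "ennreal t * g y \<le> f x * g y"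
      using t by (auto intro!: ennreal_mult_strict_left_mono mult_right_mono)
    then have "(ennreal t)\<^sup>2 < f x * g y"
      unfolding power2_eq_square by (rule less_le_trans)
    also have "\<dots> \<le> (h ((x + y) / 2))\<^sup>2" by (rule fgh)
    finally show "(x + y) / 2 \<in> {x. ennreal t < h x}"
      by (simp add: power_mono not_le[symmetric]) (meson power_mono zero_le)
  qed (use fs gs t in \<open>auto simp: ennreal_less_one_iff\<close>)
  have "(\<integral>\<^sup>+x. f x \<partial>lborel) + (\<integral>\<^sup>+x. g x \<partial>lborel)
      = (\<integral>\<^sup>+x. min 1 (f x) \<partial>lborel) + (\<integral>\<^sup>+x. min 1 (g x) \<partial>lborel)"
    using f1 g1 by (simp add: min_absorb2)
  also have "\<dots> = (\<integral>\<^sup>+t. indicator {0<..<1} t * (?lev f t + ?lev g t) \<partial>lborel)"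
    by (simp add: layer_cake distrib_left nn_integral_add)
  also have "\<dots> \<le> (\<integral>\<^sup>+t. 2 * (indicator {0<..<1} t * ?lev h t) \<partial>lborel)"
    by (intro nn_integral_mono) (use bm in \<open>auto split: split_indicator\<close>)
  also have "\<dots> = 2 * (\<integral>\<^sup>+x. min 1 (h x) \<partial>lborel)"
    by (simp add: layer_cake nn_integral_cmult)
  also have "\<dots> \<le> 2 * (\<integral>\<^sup>+x. h x \<partial>lborel)"
    by (intro mult_left_mono nn_integral_mono) auto
  finally have "((\<integral>\<^sup>+x. f x \<partial>lborel) + (\<integral>\<^sup>+x. g x \<partial>lborel))\<^sup>2 \<le> (2 * (\<integral>\<^sup>+x. h x \<partial>lborel))\<^sup>2"
    by (intro power_mono) auto
  then have "4 * ((\<integral>\<^sup>+x. f x \<partial>lborel) * (\<integral>\<^sup>+x. g x \<partial>lborel)) \<le> 4 * (\<integral>\<^sup>+x. h x \<partial>lborel)\<^sup>2"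
    using order_trans[OF ennreal_four_mult_le] by (simp add: power_mult_distrib)
  then show ?thesis
    by (subst (asm) ennreal_mult_le_mult_iff) auto
qed

text \<open>Rescaling \<open>f\<close>, \<open>g\<close>, \<open>h\<close> by the suprema \<open>p\<close>, \<open>q\<close> and by \<open>sqrt (p * q)\<close> divides both
  sides of the hypothesis and of the conclusion by \<open>p * q\<close>.\<close>
lemma prekopa_leindler_bounded:
  fixes f g h :: "real \<Rightarrow> ennreal"
  assumes [measurable]: "f \<in> borel_measurable borel" "g \<in> borel_measurable borel" "h \<in> borel_measurable borel"
    and fK: "\<And>x. f x \<le> ennreal K" and gK: "\<And>x. g x \<le> ennreal K"
    and fgh: "\<And>x y. f x * g y \<le> (h ((x + y) / 2))\<^sup>2"
  shows "(\<integral>\<^sup>+x. f x \<partial>lborel) * (\<integral>\<^sup>+x. g x \<partial>lborel) \<le> (\<integral>\<^sup>+x. h x \<partial>lborel)\<^sup>2"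
proof (cases "(SUP x. f x) = 0 \<or> (SUP x. g x) = 0")
  case True
  then have "(\<forall>x. f x = 0) \<or> (\<forall>x. g x = 0)"
    by (metis SUP_upper UNIV_I le_zero_eq)
  then show ?thesis by auto
next
  case False
  have "(SUP x. f x) \<le> ennreal K" "(SUP x. g x) \<le> ennreal K"
    using fK gK by (auto intro: SUP_least)
  then obtain p q where p: "(SUP x. f x) = ennreal p" "0 < p" and q: "(SUP x. g x) = ennreal q" "0 < q"
    using False by (metis ennreal_cases ennreal_0 ennreal_less_top less_eq_real_def not_le top.not_eq_extremum)
  define r where "r = sqrt (p * q)"
  have r: "0 < r" "r\<^sup>2 = p * q" using p q by (auto simp: r_def)
  have inv: "ennreal (1 / c) * (ennreal c * v) = v" if "0 < c" for c v
  proof -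
    have "ennreal (1 / c) * ennreal c = ennreal ((1 / c) * c)"
      using that by (subst ennreal_mult) auto
    then show ?thesis using that by (simp add: mult.assoc[symmetric])
  qed
  define k where "k = ennreal (1 / p) * ennreal (1 / q)"
  have k: "k = (ennreal (1 / r))\<^sup>2" "k \<noteq> 0" "k \<noteq> top"
    using p q r
    by (auto simp: k_def ennreal_mult[symmetric] ennreal_power power_one_over)
  let ?F = "\<lambda>x. ennreal (1 / p) * f x" and ?G = "\<lambda>x. ennreal (1 / q) * g x"
    and ?H = "\<lambda>x. ennreal (1 / r) * h x"
  have le1: "ennreal (1 / c) * u x \<le> 1" if "(SUP x. u x) = ennreal c" "0 < c"
    for u :: "real \<Rightarrow> ennreal" and c x
  proof -
    have "u x \<le> ennreal c * 1" using that SUP_upper[of x UNIV u] by simp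
    then have "ennreal (1 / c) * u x \<le> ennreal (1 / c) * (ennreal c * 1)"
      by (rule mult_left_mono) simp
    then show ?thesis using inv[OF that(2), of 1] by simp
  qed
  have near1: "\<exists>x. t < ennreal (1 / c) * u x" if c: "(SUP x. u x) = ennreal c" "0 < c" "t < 1"
    for u :: "real \<Rightarrow> ennreal" and c t
  proof -
    have "ennreal c * t < ennreal c * 1"
      using c by (intro ennreal_mult_strict_left_mono) auto
    then have "ennreal c * t < (SUP x. u x)" by (simp add: c(1))
    then obtain x where "ennreal c * t < u x"
      by (auto simp: less_SUP_iff)
    then have "ennreal (1 / c) * (ennreal c * t) < ennreal (1 / c) * u x"
      using c by (intro ennreal_mult_strict_left_mono) auto
    then show ?thesis using inv[OF c(2)] by auto
  qed
  have "(\<integral>\<^sup>+x. ?F x \<partial>lborel) * (\<integral>\<^sup>+x. ?G x \<partial>lborel) \<le> (\<integral>\<^sup>+x. ?H x \<partial>lborel)\<^sup>2"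
  proof (rule prekopa_leindler_normalized)
    fix x y
    have "?F x * ?G y = k * (f x * g y)" by (simp add: k_def ac_simps)
    also have "\<dots> \<le> k * (h ((x + y) / 2))\<^sup>2" by (intro mult_left_mono fgh) auto
    finally show "?F x * ?G y \<le> (?H ((x + y) / 2))\<^sup>2" by (simp add: k power_mult_distrib)
  qed (simp, simp, simp, rule le1[OF p], rule le1[OF q], rule near1[OF p], assumption,
      rule near1[OF q], assumption)
  then have "k * ((\<integral>\<^sup>+x. f x \<partial>lborel) * (\<integral>\<^sup>+x. g x \<partial>lborel)) \<le> k * (\<integral>\<^sup>+x. h x \<partial>lborel)\<^sup>2"
    by (simp add: nn_integral_cmult k(1)[symmetric] power_mult_distrib) (simp add: k_def ac_simps)
  then show ?thesis
    using k by (subst (asm) ennreal_mult_le_mult_iff) auto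
qed

lemma prekopa_leindler_real:
  fixes f g h :: "real \<Rightarrow> ennreal"
  assumes [measurable]: "f \<in> borel_measurable borel" "g \<in> borel_measurable borel" "h \<in> borel_measurable borel"
    and fgh: "\<And>x y. f x * g y \<le> (h ((x + y) / 2))\<^sup>2"
  shows "(\<integral>\<^sup>+x. f x \<partial>lborel) * (\<integral>\<^sup>+x. g x \<partial>lborel) \<le> (\<integral>\<^sup>+x. h x \<partial>lborel)\<^sup>2"
proof -
  have sup: "(\<integral>\<^sup>+x. u x \<partial>lborel) = (SUP n. \<integral>\<^sup>+x. min (u x) (ennreal (real n)) \<partial>lborel)"
    if [measurable]: "u \<in> borel_measurable borel" for u :: "real \<Rightarrow> ennreal"
  proof -
    have inc: "incseq (\<lambda>n x. min (u x) (ennreal (real n)))"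
      by (intro monoI le_funI min.mono ennreal_leI) auto
    have "(SUP n. min (u x) (ennreal (real n))) = u x" for x
    proof (rule LIMSEQ_unique[OF LIMSEQ_SUP])
      show "incseq (\<lambda>n. min (u x) (ennreal (real n)))"
        by (intro monoI min.mono ennreal_leI) auto
      have "(\<lambda>n. ennreal (real n)) \<longlonglongrightarrow> top"
        using of_nat_tendsto_top_ennreal by (simp add: ennreal_of_nat_eq_real_of_nat)
      from tendsto_min[OF tendsto_const this, of "u x"]
      show "(\<lambda>n. min (u x) (ennreal (real n))) \<longlonglongrightarrow> u x" by (simp add: min_absorb1)
    qed
    then show ?thesis
      using nn_integral_monotone_convergence_SUP[OF inc, of lborel] by simp
  qed
  have "(\<integral>\<^sup>+x. min (f x) (ennreal (real n)) \<partial>lborel) * (\<integral>\<^sup>+x. min (g x) (ennreal (real k)) \<partial>lborel)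
      \<le> (\<integral>\<^sup>+x. h x \<partial>lborel)\<^sup>2" for n k
  proof (rule prekopa_leindler_bounded[where K="real (max n k)"])
    fix x y
    have "min (f x) (ennreal (real n)) * min (g y) (ennreal (real k)) \<le> f x * g y"
      by (intro mult_mono) auto
    then show "min (f x) (ennreal (real n)) * min (g y) (ennreal (real k)) \<le> (h ((x + y) / 2))\<^sup>2"
      using fgh order_trans by blast
  qed (auto intro!: min.coboundedI2 ennreal_leI)
  then show ?thesis
    unfolding sup[OF assms(1)] sup[OF assms(2)]
    by (simp only: SUP_mult_right_ennreal SUP_mult_left_ennreal) (intro SUP_least)
qed

lemma nn_integral_PiM_empty:
  "(\<integral>\<^sup>+x. u x \<partial>PiM {} M) = u (\<lambda>_. undefined)"
proof -
  have "(\<integral>\<^sup>+x. u x \<partial>PiM {} M)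
      = (\<integral>\<^sup>+x. u (\<lambda>_. undefined) * indicator {\<lambda>_. undefined} x \<partial>PiM {} M)"
    by (intro nn_integral_cong) (auto simp: space_PiM_empty)
  then show ?thesis
    by (simp add: nn_integral_cmult_indicator sets_PiM_empty)
qed

text \<open>
  Integrating out all coordinates but the last turns the hypothesis for \<open>f\<close>, \<open>g\<close>, \<open>h\<close> into the
  same hypothesis for three functions of one variable, by the induction hypothesis applied to the
  slices at \<open>s\<close>, \<open>t\<close> and \<open>(s + t)/2\<close>.
\<close>
lemma prekopa_leindler_midpoint:
  fixes f g h :: "(nat \<Rightarrow> real) \<Rightarrow> ennreal"
  assumes "f \<in> borel_measurable (leb d)" "g \<in> borel_measurable (leb d)" "h \<in> borel_measurable (leb d)"
    and "\<And>x y. x \<in> {..<d} \<rightarrow>\<^sub>E UNIV \<Longrightarrow> y \<in> {..<d} \<rightarrow>\<^sub>E UNIV \<Longrightarrow>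
           f x * g y \<le> (h (\<lambda>k\<in>{..<d}. (x k + y k) / 2))\<^sup>2"
  shows "(\<integral>\<^sup>+x. f x \<partial>leb d) * (\<integral>\<^sup>+x. g x \<partial>leb d) \<le> (\<integral>\<^sup>+x. h x \<partial>leb d)\<^sup>2"
  using assms
proof (induction d arbitrary: f g h)
  case 0
  interpret product_sigma_finite "\<lambda>_::nat. lborel :: real measure" by standard
  show ?case using 0(4)[of "\<lambda>_. undefined" "\<lambda>_. undefined"]
    by (simp add: leb_def nn_integral_PiM_empty restrict_def)
next
  case (Suc d)
  interpret product_sigma_finite "\<lambda>_::nat. lborel :: real measure" by standard
  have leb_Suc: "leb (Suc d) = PiM (insert d {..<d}) (\<lambda>_. lborel)"
    by (simp add: leb_def lessThan_Suc)
  have meas[measurable]: "f \<in> borel_measurable (PiM (insert d {..<d}) (\<lambda>_. lborel))"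
      "g \<in> borel_measurable (PiM (insert d {..<d}) (\<lambda>_. lborel))"
      "h \<in> borel_measurable (PiM (insert d {..<d}) (\<lambda>_. lborel))"
    using Suc.prems(1-3) by (simp_all add: leb_Suc)
  have slice: "(\<integral>\<^sup>+x. u x \<partial>leb (Suc d)) = (\<integral>\<^sup>+s. (\<integral>\<^sup>+x. u (x(d := s)) \<partial>leb d) \<partial>lborel)"
    if "u \<in> borel_measurable (PiM (insert d {..<d}) (\<lambda>_. lborel))" for u
    unfolding leb_Suc using that by (subst product_nn_integral_insert_rev) (auto simp: leb_def)
  have sl_meas: "(\<lambda>x. u (x(d := s))) \<in> borel_measurable (leb d)"
    and int_meas: "(\<lambda>s. \<integral>\<^sup>+x. u (x(d := s)) \<partial>leb d) \<in> borel_measurable borel"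
    if [measurable]: "u \<in> borel_measurable (PiM (insert d {..<d}) (\<lambda>_. lborel))" for u :: "_ \<Rightarrow> ennreal" and s
  proof -
    interpret L: sigma_finite_measure "PiM {..<d} (\<lambda>_. lborel :: real measure)"
      by (rule sigma_finite) simp
    show "(\<lambda>x. u (x(d := s))) \<in> borel_measurable (leb d)"
      unfolding leb_def by measurable
    show "(\<lambda>s. \<integral>\<^sup>+x. u (x(d := s)) \<partial>leb d) \<in> borel_measurable borel"
      unfolding leb_def by measurable
  qed
  show ?case
    unfolding slice[OF meas(1)] slice[OF meas(2)] slice[OF meas(3)]
  proof (intro prekopa_leindler_real int_meas meas)
    fix s t :: real
    show "(\<integral>\<^sup>+x. f (x(d := s)) \<partial>leb d) * (\<integral>\<^sup>+x. g (x(d := t)) \<partial>leb d)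
        \<le> (\<integral>\<^sup>+x. h (x(d := (s + t) / 2)) \<partial>leb d)\<^sup>2"
    proof (rule Suc.IH; (intro sl_meas meas)?)
      fix x y :: "nat \<Rightarrow> real"
      assume xy: "x \<in> {..<d} \<rightarrow>\<^sub>E UNIV" "y \<in> {..<d} \<rightarrow>\<^sub>E UNIV"
      have mid: "(\<lambda>k\<in>{..<Suc d}. ((x(d := s)) k + (y(d := t)) k) / 2)
          = (\<lambda>k\<in>{..<d}. (x k + y k) / 2)(d := (s + t) / 2)"
        by (auto simp: restrict_def fun_eq_iff)
      have "x(d := s) \<in> {..<Suc d} \<rightarrow>\<^sub>E UNIV" "y(d := t) \<in> {..<Suc d} \<rightarrow>\<^sub>E UNIV"
        using xy by (auto simp: PiE_def extensional_def)
      from Suc.prems(4)[OF this]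
      show "f (x(d := s)) * g (y(d := t)) \<le> (h ((\<lambda>k\<in>{..<d}. (x k + y k) / 2)(d := (s + t) / 2)))\<^sup>2"
        unfolding mid .
    qed
  qed
qed

section \<open>Exponential tails of log-concave vectors\<close>

lemma sets_leb [measurable_cong]: "sets (leb d) = sets (Rd d)"
  unfolding leb_def Rd_def by (intro sets_PiM_cong) auto

lemma ip_measurable [measurable]: "(\<lambda>x. ip d x \<theta>) \<in> borel_measurable (Rd d)"
  unfolding ip_def Rd_def by measurable

text \<open>Prekopa-Leindler for the density restricted to three parallel half-spaces: midpoints of
  points of the outer two lie in the middle one.\<close>
lemma log_concave_half_spaces:
  fixes \<theta> :: "nat \<Rightarrow> real"
  assumes lc: "log_concave_fun d f"
    and [measurable]: "(\<lambda>x. ennreal (f x)) \<in> borel_measurable (leb d)"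
  defines "G \<equiv> \<lambda>s. \<integral>\<^sup>+x. ennreal (f x) * indicator {x. s < ip d x \<theta>} x \<partial>leb d"
  shows "G s * G t \<le> (G ((s + t) / 2))\<^sup>2"
  unfolding G_def
proof (rule prekopa_leindler_midpoint)
  fix x y :: "nat \<Rightarrow> real"
  assume xy: "x \<in> {..<d} \<rightarrow>\<^sub>E UNIV" "y \<in> {..<d} \<rightarrow>\<^sub>E UNIV"
  let ?z = "\<lambda>k\<in>{..<d}. (x k + y k) / 2"
  have nn: "0 \<le> f x" "0 \<le> f y" "0 \<le> f ?z"
    using lc xy by (auto simp: log_concave_fun_def)
  have z: "(\<lambda>k\<in>{..<d}. (1 - 1/2) * x k + (1/2) * y k) = ?z"
    by (auto simp: restrict_def fun_eq_iff field_simps)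
  have "(1/2 :: real) \<in> {0<..<1}" by simp
  then have "f x powr (1 - 1/2) * f y powr (1/2) \<le> f (\<lambda>k\<in>{..<d}. (1 - 1/2) * x k + (1/2) * y k)"
    using lc xy unfolding log_concave_fun_def by blast
  then have "sqrt (f x) * sqrt (f y) \<le> f ?z"
    unfolding z using nn by (simp add: powr_half_sqrt)
  then have "(sqrt (f x) * sqrt (f y))\<^sup>2 \<le> (f ?z)\<^sup>2"
    using nn by (intro power_mono) auto
  then have "f x * f y \<le> (f ?z)\<^sup>2" using nn by (simp add: power_mult_distrib)
  then have le: "ennreal (f x) * ennreal (f y) \<le> (ennreal (f ?z))\<^sup>2"
    using nn by (simp add: ennreal_mult[symmetric] ennreal_power ennreal_leI)
  have "ip d ?z \<theta> = (ip d x \<theta> + ip d y \<theta>) / 2"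
  proof -
    have "ip d ?z \<theta> = (\<Sum>k<d. (x k * \<theta> k + y k * \<theta> k) / 2)"
      unfolding ip_def by (intro sum.cong) (auto simp: field_simps)
    then show ?thesis by (simp add: ip_def sum.distrib flip: sum_divide_distrib)
  qed
  then have "s < ip d x \<theta> \<Longrightarrow> t < ip d y \<theta> \<Longrightarrow> (s + t) / 2 < ip d ?z \<theta>" by simp
  then show "ennreal (f x) * indicator {x. s < ip d x \<theta>} x * (ennreal (f y) * indicator {x. t < ip d x \<theta>} y)
      \<le> (ennreal (f ?z) * indicator {x. (s + t) / 2 < ip d x \<theta>} ?z)\<^sup>2"
    using le by (auto split: split_indicator)
qed measurable

text \<open>
  Along the progression \<open>-3, 3, 9, \<dots>\<close> log-concavity says that the ratios of consecutive values
  decrease. The first ratio is at most \<open>1/8\<close>, and \<open>1/8 \<le> exp (- 2)\<close> over a step of length \<open>6\<close> is the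
  rate \<open>1/3\<close>. The summand \<open>1\<close> in the exponent pays for rounding \<open>t\<close> down to the progression.
\<close>
lemma midpoint_log_concave_decay:
  fixes G :: "real \<Rightarrow> real"
  assumes nn: "\<And>t. 0 \<le> G t" and le1: "\<And>t. G t \<le> 1" and anti: "antimono G"
    and mid: "\<And>s t. G s * G t \<le> (G ((s + t) / 2))\<^sup>2"
    and lo: "8 / 9 \<le> G (- 3)" and hi: "G 3 \<le> 1 / 9"
  shows "G t \<le> exp (1 - t / 3)"
proof -
  define g where "g k = G (6 * real k - 3)" for k
  have ratio: "g (Suc k) \<le> g k / 8" for k
  proof (induction k)
    case 0
    then show ?case using lo hi by (simp add: g_def)
  next
    case (Suc k)
    have "g (Suc (Suc k)) \<le> g (Suc k)"
      unfolding g_def by (intro antimonoD[OF anti]) auto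
    moreover have "(6 * real k - 3 + (6 * real (Suc (Suc k)) - 3)) / 2 = 6 * real (Suc k) - 3"
      by (simp add: field_simps)
    then have "g k * g (Suc (Suc k)) \<le> (g (Suc k))\<^sup>2"
      unfolding g_def using mid by metis
    moreover have "(g (Suc k))\<^sup>2 \<le> (g k / 8) * g (Suc k)"
      unfolding power2_eq_square using Suc nn by (intro mult_right_mono) (auto simp: g_def)
    ultimately have "g k * g (Suc (Suc k)) \<le> g k * (g (Suc k) / 8)" "g (Suc (Suc k)) \<le> g (Suc k)"
      by auto
    moreover have "0 \<le> g k" "0 \<le> g (Suc (Suc k))" by (auto simp: g_def nn)
    \<comment> \<open>If \<open>g k\<close> vanishes, there is no ratio to compare, but then later values vanish by monotonicity.\<close>
    ultimately show ?case
      using Suc by (cases "g k = 0") auto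
  qed
  have "exp 1 * exp (1::real) \<le> (272/100) * (272/100)"
    using e_less_272 by (intro mult_mono) auto
  then have e2: "exp (2::real) \<le> 8" by (simp flip: exp_add)
  have g: "g k \<le> exp (- 2 * real k)" for k
  proof (induction k)
    case 0
    then show ?case using le1 by (simp add: g_def)
  next
    case (Suc k)
    have "g (Suc k) \<le> exp (- 2 * real k) / 8" using ratio[of k] Suc by simp
    also have "\<dots> \<le> exp (- 2 * real k) / exp 2" using e2 by (intro divide_left_mono) auto
    also have "\<dots> = exp (- 2 * real (Suc k))" by (simp flip: exp_diff add: algebra_simps)
    finally show ?case .
  qed
  show ?thesis
  proof (cases "t \<le> 3")
    case True
    then have "1 \<le> exp (1 - t / 3)" by simp
    then show ?thesis using le1[of t] by linarith
  next
    case False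
    define k where "k = nat \<lfloor>(t + 3) / 6\<rfloor>"
    have "0 \<le> \<lfloor>(t + 3) / 6\<rfloor>" using False by simp
    then have "real k = of_int \<lfloor>(t + 3) / 6\<rfloor>" by (simp add: k_def)
    then have k: "real k \<le> (t + 3) / 6" "(t + 3) / 6 < real k + 1" by linarith+
    have "G t \<le> g k" unfolding g_def using k by (intro antimonoD[OF anti]) auto
    also have "\<dots> \<le> exp (- 2 * real k)" by (rule g)
    also have "\<dots> \<le> exp (1 - t / 3)" using k by simp
    finally show ?thesis .
  qed
qed

text \<open>Chebyshev's inequality at distance 3 from the origin supplies the two values that start the
  geometric decay.\<close>
lemma log_concave_exponential_tail:
  assumes "prob_space M" and lc: "log_concave d M X"
    and int: "integrable M (\<lambda>\<omega>. (ip d (X \<omega>) \<theta>)\<^sup>2)" and var: "(\<integral>\<omega>. (ip d (X \<omega>) \<theta>)\<^sup>2 \<partial>M) \<le> 1"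
  shows "measure M {\<omega> \<in> space M. t < ip d (X \<omega>) \<theta>} \<le> exp (1 - t / 3)"
proof -
  interpret prob_space M by fact
  obtain f where f: "log_concave_fun d f" and dens: "distributed M (leb d) X (\<lambda>x. ennreal (f x))"
    using lc by (auto simp: log_concave_def)
  have X[measurable]: "X \<in> measurable M (Rd d)"
    using distributed_measurable[OF dens] measurable_cong_sets[OF refl sets_leb] by metis
  have fm[measurable]: "(\<lambda>x. ennreal (f x)) \<in> borel_measurable (leb d)"
    using distributed_borel_measurable[OF dens] .
  define G where "G t = prob {\<omega> \<in> space M. t < ip d (X \<omega>) \<theta>}" for t
  have eG: "ennreal (G s) = (\<integral>\<^sup>+x. ennreal (f x) * indicator {x. s < ip d x \<theta>} x \<partial>leb d)" for s
  proof -
    have S: "{x \<in> space (leb d). s < ip d x \<theta>} \<in> sets (leb d)" by measurable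
    have "ennreal (G s) = emeasure M (X -` {x \<in> space (leb d). s < ip d x \<theta>} \<inter> space M)"
      unfolding G_def emeasure_eq_measure
      using measurable_space[OF distributed_measurable[OF dens]]
      by (intro arg_cong[where f="\<lambda>A. ennreal (prob A)"]) auto
    also have "\<dots> = (\<integral>\<^sup>+x. ennreal (f x) * indicator {x \<in> space (leb d). s < ip d x \<theta>} x \<partial>leb d)"
      by (rule distributed_emeasure[OF dens S])
    also have "\<dots> = (\<integral>\<^sup>+x. ennreal (f x) * indicator {x. s < ip d x \<theta>} x \<partial>leb d)"
      by (intro nn_integral_cong) (auto split: split_indicator)
    finally show ?thesis .
  qed
  have Gnn: "0 \<le> G s" for s by (simp add: G_def)
  have mid: "G s * G t \<le> (G ((s + t) / 2))\<^sup>2" for s t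
    using log_concave_half_spaces[OF f fm, of s \<theta> t]
    unfolding eG[symmetric] by (simp add: ennreal_mult[symmetric] ennreal_power Gnn)
  have cheb: "prob {\<omega> \<in> space M. 9 \<le> (ip d (X \<omega>) \<theta>)\<^sup>2} \<le> 1 / 9"
    using integral_Markov_inequality_measure[OF int, of "{}" 9] var by simp
  have "G 3 \<le> prob {\<omega> \<in> space M. 9 \<le> (ip d (X \<omega>) \<theta>)\<^sup>2}"
    unfolding G_def
  proof (intro finite_measure_mono subsetI CollectI conjI)
    fix \<omega> assume "\<omega> \<in> {\<omega> \<in> space M. 3 < ip d (X \<omega>) \<theta>}"
    then show "9 \<le> (ip d (X \<omega>) \<theta>)\<^sup>2" using power_mono[of 3 "ip d (X \<omega>) \<theta>" 2] by simp
  qed auto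
  then have hi: "G 3 \<le> 1 / 9" using cheb by linarith
  have "1 - G (-3) = prob (space M - {\<omega> \<in> space M. -3 < ip d (X \<omega>) \<theta>})"
    unfolding G_def by (intro prob_compl[symmetric]) measurable
  also have "\<dots> \<le> prob {\<omega> \<in> space M. 9 \<le> (ip d (X \<omega>) \<theta>)\<^sup>2}"
  proof (intro finite_measure_mono subsetI CollectI conjI)
    fix \<omega> assume "\<omega> \<in> space M - {\<omega> \<in> space M. -3 < ip d (X \<omega>) \<theta>}"
    then have "3 \<le> - ip d (X \<omega>) \<theta>" by auto
    then show "9 \<le> (ip d (X \<omega>) \<theta>)\<^sup>2" using power_mono[of 3 "- ip d (X \<omega>) \<theta>" 2] by simp
  qed auto
  finally have lo: "8 / 9 \<le> G (-3)" using cheb by linarith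
  have "antimono G"
    unfolding G_def by (intro antimonoI finite_measure_mono) auto
  from midpoint_log_concave_decay[OF Gnn _ this mid lo hi]
  show ?thesis by (simp add: G_def)
qed

section \<open>Cells of the unit interval and cell means\<close>

text \<open>Half-open intervals, so that the cells partition \<open>(0, 1]\<close> and the ceiling function finds the
  cell of a point.\<close>
definition cell :: "nat \<Rightarrow> nat \<Rightarrow> real set" where
  "cell m i = {(real i - 1) / real m <.. real i / real m}"

definition step :: "nat \<Rightarrow> (nat \<Rightarrow> real) \<Rightarrow> real \<Rightarrow> real" where
  "step m a u = a (nat \<lceil>real m * u\<rceil>)"

lemma cell_borel [measurable]: "cell m i \<in> sets borel"
  by (simp add: cell_def)

lemma step_measurable [measurable]: "step m a \<in> borel_measurable borel"
  unfolding step_def by measurable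

lemma emeasure_cell: "m \<ge> 1 \<Longrightarrow> emeasure lborel (cell m i) = ennreal (1 / real m)"
  unfolding cell_def by (subst emeasure_lborel_Ioc) (auto simp: divide_right_mono diff_divide_distrib)

lemma mem_cell_iff:
  assumes "m \<ge> 1" "i \<ge> 1" shows "u \<in> cell m i \<longleftrightarrow> nat \<lceil>real m * u\<rceil> = i"
proof -
  have "u \<in> cell m i \<longleftrightarrow> real i - 1 < real m * u \<and> real m * u \<le> real i"
    using assms by (simp add: cell_def pos_divide_less_eq pos_le_divide_eq mult.commute)
  also have "\<dots> \<longleftrightarrow> \<lceil>real m * u\<rceil> = int i" by (simp add: ceiling_eq_iff)
  also have "\<dots> \<longleftrightarrow> nat \<lceil>real m * u\<rceil> = i" using assms by linarith
  finally show ?thesis .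
qed

lemma step_on_cell: "m \<ge> 1 \<Longrightarrow> i \<ge> 1 \<Longrightarrow> u \<in> cell m i \<Longrightarrow> step m a u = a i"
  by (simp add: step_def mem_cell_iff)

lemma cell_subset:
  assumes "i \<in> {1..m}" shows "cell m i \<subseteq> {0<..1}"
proof -
  have "0 \<le> (real i - 1) / real m" "real i / real m \<le> 1" using assms by auto
  then show ?thesis by (auto simp: cell_def)
qed

lemma sum_indicator_cells:
  assumes "m \<ge> 1"
  shows "(\<Sum>i=1..m. indicator (cell m i) u) = (indicator {0<..1} u :: 'a :: semiring_1)"
proof (cases "u \<in> {0<..1}")
  case True
  let ?k = "nat \<lceil>real m * u\<rceil>"
  have "0 < real m * u" "real m * u \<le> real m * 1" using True assms by (auto intro!: mult_left_mono)
  then have "1 \<le> \<lceil>real m * u\<rceil>" "\<lceil>real m * u\<rceil> \<le> int m" by (simp_all add: ceiling_le_iff)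
  then have k: "?k \<in> {1..m}" by (simp add: nat_le_iff le_nat_iff)
  have "(\<Sum>i=1..m. indicator (cell m i) u) = (\<Sum>i=1..m. if i = ?k then 1 else 0 :: 'a)"
    using assms by (intro sum.cong) (auto simp: mem_cell_iff indicator_def)
  then show ?thesis using k True by simp
next
  case False
  then have "u \<notin> cell m i" if "i \<in> {1..m}" for i using cell_subset[OF that] by blast
  then show ?thesis using False by (auto intro!: sum.neutral)
qed

lemma nn_integral_cells:
  assumes "m \<ge> 1" and [measurable]: "g \<in> borel_measurable borel"
  shows "(\<integral>\<^sup>+u. g u * indicator {0<..<1} u \<partial>lborel) = (\<Sum>i=1..m. \<integral>\<^sup>+u. g u * indicator (cell m i) u \<partial>lborel)"
proof -
  have "(\<integral>\<^sup>+u. g u * indicator {0<..<1} u \<partial>lborel) = (\<integral>\<^sup>+u. g u * indicator {0<..1} u \<partial>lborel)"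
    by (intro nn_integral_cong_AE eventually_mono[OF AE_lborel_singleton[of 1]])
      (auto split: split_indicator)
  also have "\<dots> = (\<integral>\<^sup>+u. (\<Sum>i=1..m. g u * indicator (cell m i) u) \<partial>lborel)"
    using assms by (simp add: sum_indicator_cells del: One_nat_def flip: sum_distrib_left)
  also have "\<dots> = (\<Sum>i=1..m. \<integral>\<^sup>+u. g u * indicator (cell m i) u \<partial>lborel)"
    by (subst nn_integral_sum) auto
  finally show ?thesis .
qed

lemma integral_cells:
  fixes g :: "real \<Rightarrow> real"
  assumes "m \<ge> 1" and int: "set_integrable lborel {0<..1} g"
  shows "(LBINT u:{0<..<1}. g u) = (\<Sum>i=1..m. LBINT u:cell m i. g u)"
proof -
  have "(LBINT u:{0<..<1}. g u) = (LBINT u:{0<..1}. g u)"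
    unfolding set_lebesgue_integral_def
    by (rule integral_discrete_difference[of "{1}"]) (auto split: split_indicator)
  also have "\<dots> = (LBINT u. \<Sum>i=1..m. indicator (cell m i) u *\<^sub>R g u)"
    using assms by (simp add: set_lebesgue_integral_def sum_indicator_cells del: One_nat_def flip: sum_distrib_right)
  also have "\<dots> = (\<Sum>i=1..m. LBINT u:cell m i. g u)"
    unfolding set_lebesgue_integral_def
  proof (rule Bochner_Integration.integral_sum)
    fix i assume "i \<in> {1..m}"
    from set_integrable_subset[OF int _ cell_subset[OF this]]
    show "integrable lborel (\<lambda>u. indicator (cell m i) u *\<^sub>R g u)"
      by (simp add: set_integrable_def)
  qed
  finally show ?thesis .
qed

text \<open>The integral of \<open>(c - q)\<^sup>2\<close> as a quadratic polynomial in \<open>c\<close>; the decomposition around the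
  mean is its completed square.\<close>
lemma integral_square_shift:
  fixes q :: "real \<Rightarrow> real"
  assumes [measurable]: "S \<in> sets M" and S: "emeasure M S < \<infinity>"
    and q: "set_integrable M S q" "set_integrable M S (\<lambda>u. (q u)\<^sup>2)"
  shows "(LINT u:S|M. (c - q u)\<^sup>2) = c\<^sup>2 * measure M S - 2 * c * (LINT u:S|M. q u) + (LINT u:S|M. (q u)\<^sup>2)"
    and "set_integrable M S (\<lambda>u. (c - q u)\<^sup>2)"
proof -
  have c: "set_integrable M S (\<lambda>_. c\<^sup>2)"
    using S unfolding set_integrable_def by (auto simp: integrable_mult_left_iff)
  have e: "(c - v)\<^sup>2 = (c\<^sup>2 - 2 * c * v) + v\<^sup>2" for v by (simp add: power2_eq_square algebra_simps)
  have q': "set_integrable M S (\<lambda>u. 2 * c * q u)" using q(1) by simp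
  have cq: "set_integrable M S (\<lambda>u. c\<^sup>2 - 2 * c * q u)" using set_integral_diff(1)[OF c q'] .
  show "set_integrable M S (\<lambda>u. (c - q u)\<^sup>2)" unfolding e using set_integral_add(1)[OF cq q(2)] .
  have "(LINT u:S|M. c\<^sup>2) = c\<^sup>2 * measure M S"
    using S by (simp add: set_integral_const mult.commute)
  moreover have "(LINT u:S|M. 2 * c * q u) = 2 * c * (LINT u:S|M. q u)" by simp
  ultimately show "(LINT u:S|M. (c - q u)\<^sup>2) = c\<^sup>2 * measure M S - 2 * c * (LINT u:S|M. q u) + (LINT u:S|M. (q u)\<^sup>2)"
    unfolding e set_integral_add(2)[OF cq q(2)] set_integral_diff(2)[OF c q'] by simp
qed

lemma set_integral_nonneg_sq: "0 \<le> (LBINT u:S. (f u)\<^sup>2)" for f :: "real \<Rightarrow> real"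
  unfolding set_lebesgue_integral_def by (intro Bochner_Integration.integral_nonneg) auto

definition cell_mean :: "nat \<Rightarrow> (real \<Rightarrow> real) \<Rightarrow> nat \<Rightarrow> real" where
  "cell_mean m q i = real m * (LBINT u:cell m i. q u)"

definition residual :: "nat \<Rightarrow> (real \<Rightarrow> real) \<Rightarrow> real" where
  "residual m q = (\<Sum>i=1..m. LBINT u:cell m i. (cell_mean m q i - q u)\<^sup>2)"

locale square_integrable =
  fixes q :: "real \<Rightarrow> real"
  assumes meas [measurable]: "q \<in> borel_measurable borel"
    and sq: "integrable lborel (\<lambda>u. (q u)\<^sup>2)"
begin

lemma set_integrable_sq: "S \<in> sets borel \<Longrightarrow> set_integrable lborel S (\<lambda>u. (q u)\<^sup>2)"
  unfolding set_integrable_def using integrable_mult_indicator[OF _ sq, of S] by simp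

lemma set_integrable_q:
  assumes [measurable]: "S \<in> sets borel" and S: "emeasure lborel S < \<infinity>"
  shows "set_integrable lborel S q"
proof (rule set_integrable_bound)
  have "set_integrable lborel S (\<lambda>_. 1::real)"
    using S unfolding set_integrable_def by (auto simp: integrable_mult_left_iff)
  from set_integral_add(1)[OF this set_integrable_sq]
  show "set_integrable lborel S (\<lambda>u. 1 + (q u)\<^sup>2)" by simp
  have "\<bar>v\<bar> \<le> 1 + v\<^sup>2" for v :: real
    using zero_le_power2[of "\<bar>v\<bar> - 1"] by (simp add: power2_eq_square algebra_simps)
  then show "AE x in lborel. x \<in> S \<longrightarrow> norm (q x) \<le> norm (1 + (q x)\<^sup>2)"
    by (auto intro!: AE_I2 simp: order_trans[OF _ abs_ge_self])
qed (auto simp: set_borel_measurable_def)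

lemma cell_square_shift:
  assumes "m \<ge> 1"
  shows "(LBINT u:cell m i. (c - q u)\<^sup>2)
    = (c - cell_mean m q i)\<^sup>2 / real m + (LBINT u:cell m i. (cell_mean m q i - q u)\<^sup>2)"
proof -
  have fin: "emeasure lborel (cell m i) < \<infinity>" and mc: "measure lborel (cell m i) = 1 / real m"
    using assms by (simp_all add: emeasure_cell measure_def)
  note sh = integral_square_shift(1)[OF _ fin set_integrable_q[OF _ fin] set_integrable_sq, unfolded mc]
  have A: "(LBINT u:cell m i. q u) = cell_mean m q i / real m"
    using assms by (simp add: cell_mean_def)
  show ?thesis
    using assms by (subst (1 2) sh) (simp_all add: A field_simps power2_eq_square)
qed

lemma cell_square_shift_le:
  assumes "m \<ge> 1"
  shows "(LBINT u:cell m i. (cell_mean m q i - q u)\<^sup>2) \<le> (LBINT u:cell m i. (c - q u)\<^sup>2)"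
  using assms by (simp add: cell_square_shift[of m i c])

text \<open>Pythagoras for the orthogonal projection of \<open>q\<close> onto functions constant on cells.\<close>
lemma step_distance:
  assumes "m \<ge> 1"
  shows "(LBINT u:{0<..<1}. (step m a u - q u)\<^sup>2)
    = 1 / real m * (\<Sum>i=1..m. (a i - cell_mean m q i)\<^sup>2) + residual m q"
proof -
  have cell: "set_integrable lborel (cell m i) (\<lambda>u. (step m a u - q u)\<^sup>2) \<and>
      (LBINT u:cell m i. (step m a u - q u)\<^sup>2) = (LBINT u:cell m i. (a i - q u)\<^sup>2)"
    if i: "i \<in> {1..m}" for i
  proof -
    have fin: "emeasure lborel (cell m i) < \<infinity>" using assms by (simp add: emeasure_cell)
    have eq: "indicator (cell m i) u *\<^sub>R (step m a u - q u)\<^sup>2 = indicator (cell m i) u *\<^sub>R (a i - q u)\<^sup>2" for u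
      using i assms by (auto split: split_indicator simp: step_on_cell)
    show ?thesis
      using integral_square_shift(2)[OF _ fin set_integrable_q[OF _ fin] set_integrable_sq, of "a i"]
      unfolding set_integrable_def set_lebesgue_integral_def eq by simp
  qed
  have "integrable lborel (\<lambda>u. \<Sum>i=1..m. indicator (cell m i) u *\<^sub>R (step m a u - q u)\<^sup>2)"
    using cell by (intro Bochner_Integration.integrable_sum) (auto simp: set_integrable_def)
  then have "set_integrable lborel {0<..1} (\<lambda>u. (step m a u - q u)\<^sup>2)"
    using assms by (simp add: set_integrable_def sum_indicator_cells del: One_nat_def flip: sum_distrib_right)
  from integral_cells[OF assms this]
  have "(LBINT u:{0<..<1}. (step m a u - q u)\<^sup>2) = (\<Sum>i=1..m. LBINT u:cell m i. (a i - q u)\<^sup>2)"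
    using cell by simp
  also have "\<dots> = (\<Sum>i=1..m. (a i - cell_mean m q i)\<^sup>2 / real m + (LBINT u:cell m i. (cell_mean m q i - q u)\<^sup>2))"
    by (intro sum.cong refl cell_square_shift[OF assms])
  finally show ?thesis by (simp add: residual_def sum.distrib sum_divide_distrib)
qed

text \<open>Averaging over cells is a contraction of \<open>L\<^sub>2\<close>.\<close>
lemma sum_cell_mean_le:
  assumes "m \<ge> 1"
  shows "1 / real m * (\<Sum>i=1..m. (cell_mean m q i)\<^sup>2) \<le> (LBINT u:{0<..<1}. (q u)\<^sup>2)"
proof -
  have "0 \<le> residual m q" unfolding residual_def by (intro sum_nonneg set_integral_nonneg_sq)
  then show ?thesis using step_distance[OF assms, of "\<lambda>_. 0"] by (simp add: step_def)
qed

text \<open>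
  The cell mean is the best constant on a cell, so any other constant gives an upper bound. On an
  inner cell the value at the right end point is used, and the error is at most the
  oscillation \<open>D i\<close>; since \<open>D i \<le> 2 * B\<close> and the \<open>D i\<close> telescope to at most \<open>2 * B\<close>, their squares
  sum to at most \<open>4 * B\<^sup>2\<close>. On the two extreme cells, where \<open>q\<close> may be unbounded, the constant is 0.
\<close>
lemma residual_le:
  assumes m: "m \<ge> 1" and mono: "mono_on {0<..<1} q"
    and B: "\<And>u. 1 / real m \<le> u \<Longrightarrow> u \<le> 1 - 1 / real m \<Longrightarrow> \<bar>q u\<bar> \<le> B" and B0: "0 \<le> B"
    and E1: "(LBINT u:cell m 1. (q u)\<^sup>2) \<le> E" and Em: "(LBINT u:cell m m. (q u)\<^sup>2) \<le> E"
  shows "residual m q \<le> 4 * B\<^sup>2 / real m + 2 * E"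
proof -
  define R where "R i = (LBINT u:cell m i. (cell_mean m q i - q u)\<^sup>2)" for i
  have R0: "0 \<le> R i" for i unfolding R_def by (rule set_integral_nonneg_sq)
  have end_cell: "R i \<le> (LBINT u:cell m i. (q u)\<^sup>2)" for i
    using cell_square_shift_le[OF m, of i 0] by (simp add: R_def)
  define D where "D i = q (real i / real m) - q ((real i - 1) / real m)" for i
  have mid: "R i \<le> (D i)\<^sup>2 / real m" "0 \<le> D i" "D i \<le> 2 * B" if i: "i \<in> {2..<m}" for i
  proof -
    have pts: "0 < (real i - 1) / real m" "(real i - 1) / real m \<le> real i / real m" "real i / real m < 1"
      "1 / real m \<le> (real i - 1) / real m" "real i / real m \<le> 1 - 1 / real m"
      using i by (auto simp: field_simps)
    have D: "0 \<le> D i" unfolding D_def using pts by (auto intro!: mono_onD[OF mono])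
    then show "0 \<le> D i" .
    show "D i \<le> 2 * B" unfolding D_def
      using B[of "real i / real m"] B[of "(real i - 1) / real m"] pts by (auto simp: abs_le_iff)
    have fin: "emeasure lborel (cell m i) < \<infinity>" and mc: "measure lborel (cell m i) = 1 / real m"
      using m by (simp_all add: emeasure_cell measure_def)
    have "R i \<le> (LBINT u:cell m i. (q (real i / real m) - q u)\<^sup>2)"
      unfolding R_def by (rule cell_square_shift_le[OF m])
    also have "\<dots> \<le> (LBINT u:cell m i. (D i)\<^sup>2)"
    proof (rule set_integral_mono)
      show "set_integrable lborel (cell m i) (\<lambda>u. (q (real i / real m) - q u)\<^sup>2)"
        by (rule integral_square_shift(2)[OF _ fin set_integrable_q[OF _ fin] set_integrable_sq]) auto
      show "set_integrable lborel (cell m i) (\<lambda>u. (D i)\<^sup>2)"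
        using fin unfolding set_integrable_def by (auto simp: integrable_mult_left_iff)
      fix u assume u: "u \<in> cell m i"
      then have "q ((real i - 1) / real m) \<le> q u" "q u \<le> q (real i / real m)"
        using pts by (auto intro!: mono_onD[OF mono] simp: cell_def)
      then show "(q (real i / real m) - q u)\<^sup>2 \<le> (D i)\<^sup>2"
        by (intro power_mono) (auto simp: D_def)
    qed
    also have "\<dots> = (D i)\<^sup>2 / real m" using fin mc by (simp add: set_integral_const)
    finally show "R i \<le> (D i)\<^sup>2 / real m" .
  qed
  have sumD: "(\<Sum>i\<in>{2..<m}. D i) \<le> 2 * B"
  proof (cases "m \<ge> 2")
    case True
    have "(\<Sum>i\<in>{2..<m}. D i) = q ((real m - 1) / real m) - q (1 / real m)"
    proof -
      have "(\<Sum>i\<in>{2..<n}. D i) = q ((real n - 1) / real m) - q (1 / real m)" if "n \<ge> 2" for n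
        using that by (induction n rule: nat_induct_at_least) (auto simp: D_def)
      then show ?thesis using True by blast
    qed
    moreover have "1 / real m \<le> 1 - 1 / real m" "(real m - 1) / real m = 1 - 1 / real m"
      using True by (auto simp: field_simps)
    ultimately show ?thesis
      using B[of "1 / real m"] B[of "1 - 1 / real m"] by (auto simp: abs_le_iff)
  qed (use B0 in auto)
  have "residual m q = sum R {1..m}" by (simp add: residual_def R_def)
  \<comment> \<open>For \<open>m = 1\<close> the two extreme cells coincide and are counted twice below.\<close>
  also have "\<dots> \<le> sum R ({1} \<union> {m} \<union> {2..<m})" by (intro sum_mono2 R0) auto
  also have "\<dots> \<le> R 1 + R m + sum R {2..<m}"
    using R0[of m] by (auto simp: sum.insert_if)
  also have "sum R {2..<m} \<le> (\<Sum>i\<in>{2..<m}. 2 * B / real m * D i)"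
  proof (rule sum_mono)
    fix i assume i: "i \<in> {2..<m}"
    have "R i \<le> D i * D i / real m" using mid(1)[OF i] by (simp add: power2_eq_square)
    also have "\<dots> \<le> 2 * B * D i / real m"
      using mid[OF i] by (intro divide_right_mono mult_right_mono) auto
    finally show "R i \<le> 2 * B / real m * D i" by simp
  qed
  also have "\<dots> = 2 * B / real m * (\<Sum>i\<in>{2..<m}. D i)" by (simp add: sum_distrib_left)
  also have "\<dots> \<le> 2 * B / real m * (2 * B)" using B0 sumD by (intro mult_left_mono) auto
  finally show ?thesis
    using end_cell[of 1] end_cell[of m] E1 Em by (simp add: power2_eq_square)
qed

end

section \<open>The quantile coupling\<close>

text \<open>For \<open>u \<le> 0\<close> the infimum that defines the quantile is taken over all reals and for \<open>u > 1\<close>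
  over the empty set, so that it has no meaning there. With the value 0 outside \<open>(0, 1)\<close> the function
  is measurable on the whole line and integrals over \<open>(0, 1)\<close> become integrals over the line.\<close>
definition unit_quantile :: "real measure \<Rightarrow> real \<Rightarrow> real" where
  "unit_quantile \<nu> u = (if 0 < u \<and> u < 1 then quantile \<nu> u else 0)"

context cdf_distribution
begin

lemma quantile_I: "quantile M = I"
  by (simp add: quantile_def fun_eq_iff)

lemma unit_quantile_measurable [measurable]: "unit_quantile M \<in> borel_measurable borel"
proof -
  have "(\<lambda>u. if u \<in> {0<..<1} then quantile M u else 0) \<in> borel_measurable borel"
    using measurable_CI by (subst measurable_restrict_space_iff[symmetric]) (auto simp: quantile_I)
  then show ?thesis by (simp add: unit_quantile_def[abs_def])
qed

lemma distr_unit_quantile: "distr (restrict_space lborel {0<..<1}) borel (unit_quantile M) = M"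
proof -
  have "distr (restrict_space lborel {0<..<1}) borel (unit_quantile M) = distr (restrict_space lborel {0<..<1}) borel I"
    by (intro distr_cong) (auto simp: unit_quantile_def quantile_def space_restrict_space)
  then show ?thesis using distr_I_eq_M by simp
qed

lemma mono_on_unit_quantile: "mono_on {0<..<1} (unit_quantile M)"
  using mono_I by (auto simp: mono_on_def unit_quantile_def quantile_def)

lemma unit_quantile_le_iff: "0 < u \<Longrightarrow> u < 1 \<Longrightarrow> unit_quantile M u \<le> t \<longleftrightarrow> u \<le> cdf M t"
  using pseudoinverse[of u t] by (simp add: unit_quantile_def quantile_def)

lemma integrable_unit_quantile:
  fixes g :: "real \<Rightarrow> real"
  assumes [measurable]: "g \<in> borel_measurable borel"
  shows "integrable M g \<longleftrightarrow> set_integrable lborel {0<..<1} (\<lambda>u. g (unit_quantile M u))"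
proof -
  have "integrable M g \<longleftrightarrow> integrable (distr (restrict_space lborel {0<..<1}) borel (unit_quantile M)) g"
    by (simp add: distr_unit_quantile)
  also have "\<dots> \<longleftrightarrow> integrable (restrict_space lborel {0<..<1}) (\<lambda>u. g (unit_quantile M u))"
    by (rule integrable_distr_eq) (auto intro: measurable_restrict_space1)
  also have "\<dots> \<longleftrightarrow> set_integrable lborel {0<..<1} (\<lambda>u. g (unit_quantile M u))"
    by (simp add: integrable_restrict_space set_integrable_def)
  finally show ?thesis .
qed

lemma integral_unit_quantile:
  fixes g :: "real \<Rightarrow> real"
  assumes [measurable]: "g \<in> borel_measurable borel"
  shows "(LINT x|M. g x) = (LBINT u:{0<..<1}. g (unit_quantile M u))"
proof -
  have "(LINT x|M. g x) = (LINT x|distr (restrict_space lborel {0<..<1}) borel (unit_quantile M). g x)"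
    by (simp add: distr_unit_quantile)
  also have "\<dots> = (LINT u|restrict_space lborel {0<..<1}. g (unit_quantile M u))"
    by (rule integral_distr) (auto intro: measurable_restrict_space1)
  also have "\<dots> = (LBINT u:{0<..<1}. g (unit_quantile M u))"
    by (simp add: integral_restrict_space set_lebesgue_integral_def)
  finally show ?thesis .
qed

lemma unit_quantile_power_vanish: "n > 0 \<Longrightarrow> u \<notin> {0<..<1} \<Longrightarrow> (unit_quantile M u) ^ n = 0"
  by (auto simp: unit_quantile_def)

lemma square_integrable_unit_quantile:
  assumes "integrable M (\<lambda>x. x\<^sup>2)"
  shows "square_integrable (unit_quantile M)"
proof
  have "integrable lborel (\<lambda>u. indicator {0<..<1} u *\<^sub>R (unit_quantile M u)\<^sup>2)"
    using assms integrable_unit_quantile[of "\<lambda>x. x\<^sup>2"] by (simp add: set_integrable_def)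
  also have "(\<lambda>u. indicator {0<..<1} u *\<^sub>R (unit_quantile M u)\<^sup>2) = (\<lambda>u. (unit_quantile M u)\<^sup>2)"
    by (auto simp: fun_eq_iff unit_quantile_def indicator_def)
  finally show "integrable lborel (\<lambda>u. (unit_quantile M u)\<^sup>2)" .
qed simp

end

lemma W2_le_coupling:
  fixes S T :: "'a \<Rightarrow> real"
  assumes [measurable]: "S \<in> borel_measurable U" "T \<in> borel_measurable U"
  shows "W2 (distr U borel S) (distr U borel T) \<le> sqrt (LINT u|U. (S u - T u)\<^sup>2)"
proof -
  let ?P = "distr U (borel \<Otimes>\<^sub>M borel) (\<lambda>u. (S u, T u))"
  have mem: "?P \<in> couplings (distr U borel S) (distr U borel T)"
    by (simp add: couplings_def distr_distr comp_def)
  have "W2 (distr U borel S) (distr U borel T) \<le> sqrt (LINT z|?P. (norm (fst z - snd z))\<^sup>2)"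
    unfolding W2_def
    by (rule cINF_lower[OF bdd_belowI2[of _ 0] mem]) simp
  also have "(LINT z|?P. (norm (fst z - snd z))\<^sup>2) = (LINT u|U. (norm (fst (S u, T u) - snd (S u, T u)))\<^sup>2)"
    by (rule integral_distr) measurable
  finally show ?thesis by simp
qed

lemma rearr_permutes:
  assumes "m \<ge> 1"
  shows "(\<Sum>i=1..m. g (rearr m a i)) = (\<Sum>i=1..m. g (a i))"
proof -
  let ?xs = "sort (map a [1..<Suc m])"
  have "(\<Sum>i=1..m. g (rearr m a i)) = (\<Sum>i<m. g (?xs ! i))"
    by (rule sum.reindex_bij_witness[of _ Suc "\<lambda>i. i - 1"]) (auto simp: rearr_def simp del: upt_Suc)
  also have "\<dots> = sum_list (map g ?xs)"
    by (simp add: sum_list_sum_nth atLeast0LessThan del: upt_Suc)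
  also have "\<dots> = sum_mset (image_mset g (mset ?xs))"
    by (metis mset_map sum_mset_sum_list)
  also have "\<dots> = sum_list (map g (map a [1..<Suc m]))"
    by (metis mset_map mset_sort sum_mset_sum_list)
  also have "\<dots> = (\<Sum>i=1..m. g (a i))"
    by (simp add: sum_list_distinct_conv_sum_set comp_def atLeastLessThanSuc_atLeastAtMost del: upt_Suc)
  finally show ?thesis .
qed

lemma emeasure_empirical:
  assumes "A \<in> sets (Rd d)"
  shows "emeasure (empirical d m x) A = ennreal (1 / real m) * (\<Sum>i=1..m. emeasure (return (Rd d) (x i)) A)"
proof (rule emeasure_measure_of[OF empirical_def])
  let ?\<mu> = "\<lambda>A. ennreal (1 / real m) * (\<Sum>i=1..m. emeasure (return (Rd d) (x i)) A)"
  show "sets (Rd d) \<subseteq> Pow (space (Rd d))" by (rule sets.space_closed)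
  show "positive (sets (empirical d m x)) ?\<mu>" by (simp add: positive_def)
  show "countably_additive (sets (empirical d m x)) ?\<mu>"
  proof (rule countably_additiveI)
    fix A :: "nat \<Rightarrow> _" assume A: "range A \<subseteq> sets (empirical d m x)" "disjoint_family A"
    have "sets (empirical d m x) = sets (Rd d)" by (simp add: empirical_def sets.space_closed)
    then have A': "range A \<subseteq> sets (return (Rd d) (x i))" for i using A by simp
    have "(\<Sum>n. ?\<mu> (A n)) = ennreal (1 / real m) * (\<Sum>i=1..m. \<Sum>n. emeasure (return (Rd d) (x i)) (A n))"
      by (subst ennreal_suminf_cmult) (subst suminf_sum, auto)
    also have "\<dots> = ?\<mu> (\<Union>(range A))"
      using suminf_emeasure[OF A' A(2)] by simp
    finally show "(\<Sum>n. ?\<mu> (A n)) = ?\<mu> (\<Union>(range A))" .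
  qed
  show "A \<in> sets (empirical d m x)" using assms by (simp add: empirical_def sets.space_closed)
qed

lemma sets_empirical [measurable_cong, simp]: "sets (empirical d m x) = sets (Rd d)"
  by (simp add: empirical_def sets.space_closed)

text \<open>Sorting only permutes the \<open>m\<close> atoms of mass \<open>1/m\<close>, and each of them is the image of one cell.\<close>
lemma marginal_empirical:
  assumes m: "m \<ge> 1" and x: "\<And>i. i \<in> {1..m} \<Longrightarrow> x i \<in> space (Rd d)"
  shows "marginal d (empirical d m x) \<theta>
    = distr (restrict_space lborel {0<..<1}) borel (step m (rearr m (\<lambda>j. ip d (x j) \<theta>)))"
    (is "_ = distr ?U borel ?T")
proof (rule measure_eqI)
  fix B assume "B \<in> sets (marginal d (empirical d m x) \<theta>)"
  then have [measurable]: "B \<in> sets borel" by (simp add: marginal_def)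
  let ?y = "\<lambda>j. ip d (x j) \<theta>"
  have T: "?T \<in> borel_measurable ?U" by (intro measurable_restrict_space1) simp
  have sp: "space (empirical d m x) = space (Rd d)" by (rule sets_eq_imp_space_eq) simp
  have [measurable]: "{z \<in> space (Rd d). ip d z \<theta> \<in> B} \<in> sets (Rd d)" by measurable
  have "emeasure (marginal d (empirical d m x) \<theta>) B
      = emeasure (empirical d m x) {z \<in> space (Rd d). ip d z \<theta> \<in> B}"
    unfolding marginal_def by (subst emeasure_distr) (auto simp: sp intro!: arg_cong2[where f=emeasure])
  also have "\<dots> = ennreal (1 / real m) * (\<Sum>i=1..m. indicator B (?y i))"
    using x by (subst emeasure_empirical) (auto intro!: arg_cong2[where f="(*)"] sum.cong simp: indicator_def)
  also have "(\<Sum>i=1..m. indicator B (?y i)) = (\<Sum>i=1..m. indicator B (rearr m ?y i) :: ennreal)"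
    using rearr_permutes[OF m, of "indicator B :: real \<Rightarrow> ennreal" ?y] by simp
  also have "ennreal (1 / real m) * (\<Sum>i=1..m. indicator B (rearr m ?y i))
      = (\<Sum>i=1..m. \<integral>\<^sup>+u. indicator B (?T u) * indicator (cell m i) u \<partial>lborel)"
    unfolding sum_distrib_left
  proof (rule sum.cong[OF refl])
    fix i assume i: "i \<in> {1..m}"
    have "(\<integral>\<^sup>+u. indicator B (?T u) * indicator (cell m i) u \<partial>lborel)
        = (\<integral>\<^sup>+u. indicator B (rearr m ?y i) * indicator (cell m i) u \<partial>lborel)"
      using m i by (intro nn_integral_cong) (auto simp: step_on_cell split: split_indicator)
    also have "\<dots> = indicator B (rearr m ?y i) * emeasure lborel (cell m i)"
      by (rule nn_integral_cmult_indicator) simp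
    finally show "ennreal (1 / real m) * indicator B (rearr m ?y i)
        = (\<integral>\<^sup>+u. indicator B (?T u) * indicator (cell m i) u \<partial>lborel)"
      using m by (simp add: emeasure_cell mult.commute)
  qed
  also have "\<dots> = (\<integral>\<^sup>+u. indicator B (?T u) * indicator {0<..<1} u \<partial>lborel)"
    by (rule nn_integral_cells[symmetric, OF m]) measurable
  also have "\<dots> = (\<integral>\<^sup>+u. indicator (?T -` B \<inter> {0<..<1}) u \<partial>lborel)"
    by (intro nn_integral_cong) (auto split: split_indicator)
  also have "\<dots> = emeasure lborel (?T -` B \<inter> {0<..<1})"
  proof (rule nn_integral_indicator)
    have "?T -` B \<in> sets borel" using measurable_sets[OF step_measurable, of B m "rearr m ?y"] by simp
    then show "?T -` B \<inter> {0<..<1} \<in> sets lborel" by auto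
  qed
  also have "\<dots> = emeasure (distr ?U borel ?T) B"
    by (subst emeasure_distr[OF T]) (auto simp: space_restrict_space emeasure_restrict_space)
  finally show "emeasure (marginal d (empirical d m x) \<theta>) B = emeasure (distr ?U borel ?T) B" .
qed (simp add: marginal_def)


section \<open>The residual of quantile functions with light tails\<close>

context square_integrable
begin

text \<open>
  By monotonicity \<open>\<bar>q\<bar> \<ge> \<bar>q u\<bar>\<close> on \<open>[u, 1)\<close> or on \<open>(0, u]\<close>, so Markov's inequality bounds \<open>q\<close> between
  the extreme cells. On the extreme cells \<open>q\<^sup>2 \<le> s/2 + q ^ 4/(2 s)\<close>; the weight \<open>s = L\<^sup>2 sqrt m\<close>
  balances the two terms and is also the square of the bound on the inner cells.
\<close>
lemma fourth_moment_residual: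
  assumes m: "m \<ge> 1" and mono: "mono_on {0<..<1} q" and L: "0 < L"
    and int4: "integrable lborel (\<lambda>u. (q u) ^ 4)" and le4: "(LBINT u. (q u) ^ 4) \<le> L ^ 4"
  shows "residual m q \<le> 6 * L\<^sup>2 / sqrt (real m)"
proof -
  define s where "s = L\<^sup>2 * sqrt (real m)"
  have s: "0 < s" using L m by (simp add: s_def)
  have m0: "0 < real m" using m by simp
  have slice: "v ^ 4 * measure lborel S \<le> L ^ 4"
    if [measurable]: "S \<in> sets borel" and S: "emeasure lborel S < \<infinity>" and le: "\<And>w. w \<in> S \<Longrightarrow> \<bar>v\<bar> \<le> \<bar>q w\<bar>" for v S
  proof -
    have "v ^ 4 * measure lborel S = (LBINT w. v ^ 4 * indicator S w)" using S by simp
    also have "\<dots> \<le> (LBINT w. (q w) ^ 4)"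
    proof (rule integral_mono[OF _ int4])
      show "integrable lborel (\<lambda>w. v ^ 4 * indicator S w)" using S by simp
      fix w
      have "w \<in> S \<Longrightarrow> \<bar>v\<bar> ^ 4 \<le> \<bar>q w\<bar> ^ 4" using le by (intro power_mono) auto
      then show "v ^ 4 * indicator S w \<le> (q w) ^ 4" by (auto split: split_indicator)
    qed
    finally show ?thesis using le4 by simp
  qed
  have "residual m q \<le> 4 * (sqrt s)\<^sup>2 / real m + 2 * (s / real m)"
  proof (rule residual_le[OF m mono])
    fix u assume u: "1 / real m \<le> u" "u \<le> 1 - 1 / real m"
    moreover have "0 < 1 / real m" using m by simp
    ultimately have u01: "0 < u" "u < 1" by linarith+
    have "\<exists>S. S \<in> sets borel \<and> emeasure lborel S < \<infinity> \<and> (\<forall>w\<in>S. \<bar>q u\<bar> \<le> \<bar>q w\<bar>) \<and> 1 / real m \<le> measure lborel S"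
    proof (cases "0 \<le> q u")
      case True
      have "\<forall>w\<in>{u..<1}. q u \<le> q w" using u01 by (auto intro!: mono_onD[OF mono])
      then show ?thesis using True u u01 by (intro exI[of _ "{u..<1}"]) fastforce
    next
      case False
      have "\<forall>w\<in>{0<..u}. q w \<le> q u" using u01 by (auto intro!: mono_onD[OF mono])
      then show ?thesis using False u u01 by (intro exI[of _ "{0<..u}"]) fastforce
    qed
    then obtain S where S: "S \<in> sets borel" "emeasure lborel S < \<infinity>" "\<And>w. w \<in> S \<Longrightarrow> \<bar>q u\<bar> \<le> \<bar>q w\<bar>"
      "1 / real m \<le> measure lborel S" by blast
    have "(q u) ^ 4 * (1 / real m) \<le> (q u) ^ 4 * measure lborel S"
      using S(4) by (intro mult_left_mono) auto
    also have "\<dots> \<le> L ^ 4" by (rule slice[OF S(1-3)])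
    finally have "(q u) ^ 4 \<le> L ^ 4 * real m" using m0 by (simp add: field_simps)
    also have "\<dots> = s\<^sup>2" using m by (simp add: s_def power_mult_distrib flip: power_mult)
    also have "\<dots> = ((sqrt s)\<^sup>2)\<^sup>2" using s by simp
    also have "\<dots> = (sqrt s) ^ 4" by (simp flip: power_mult)
    finally have "\<bar>q u\<bar> ^ 4 \<le> (sqrt s) ^ 4" by simp
    then show "\<bar>q u\<bar> \<le> sqrt s" using s by (subst (asm) power_mono_iff) auto
  next
    have E: "(LBINT u:cell m i. (q u)\<^sup>2) \<le> s / real m" for i
    proof -
      have fin: "emeasure lborel (cell m i) < \<infinity>" and mc: "measure lborel (cell m i) = 1 / real m"
        using m by (simp_all add: emeasure_cell measure_def)
      have amgm: "x\<^sup>2 \<le> s / 2 + x ^ 4 / (2 * s)" for x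
      proof -
        have "0 \<le> (x\<^sup>2 - s)\<^sup>2 / (2 * s)" using s by simp
        also have "\<dots> = s / 2 + x ^ 4 / (2 * s) - x\<^sup>2" using s by (simp add: field_simps power2_eq_square power4_eq_xxxx)
        finally show ?thesis by simp
      qed
      have "(LBINT u:cell m i. (q u)\<^sup>2) \<le> (LBINT u. s / 2 * indicator (cell m i) u + (q u) ^ 4 / (2 * s))"
        unfolding set_lebesgue_integral_def
      proof (rule integral_mono)
        show "integrable lborel (\<lambda>u. indicator (cell m i) u *\<^sub>R (q u)\<^sup>2)"
          using set_integrable_sq[of "cell m i"] by (simp add: set_integrable_def)
        show "integrable lborel (\<lambda>u. s / 2 * indicator (cell m i) u + (q u) ^ 4 / (2 * s))"
          using int4 fin by auto
        fix u show "indicator (cell m i) u *\<^sub>R (q u)\<^sup>2 \<le> s / 2 * indicator (cell m i) u + (q u) ^ 4 / (2 * s)"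
          using amgm[of "q u"] s by (auto split: split_indicator)
      qed
      also have "\<dots> = s / (2 * real m) + (LBINT u. (q u) ^ 4) / (2 * s)"
        using int4 fin mc by (subst Bochner_Integration.integral_add) auto
      also have "\<dots> \<le> s / (2 * real m) + L ^ 4 / (2 * s)"
        using le4 s by (intro add_left_mono divide_right_mono) auto
      also have "L ^ 4 / (2 * s) = s / (2 * real m)"
      proof -
        have "L ^ 4 * real m = s * s" using m
          by (simp add: s_def power_mult_distrib power2_eq_square power4_eq_xxxx)
        then show ?thesis using s m0 by (simp add: field_simps)
      qed
      finally show ?thesis by simp
    qed
    show "(LBINT u:cell m 1. (q u)\<^sup>2) \<le> s / real m" "(LBINT u:cell m m. (q u)\<^sup>2) \<le> s / real m"
      by (rule E)+
  qed (use s in simp)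
  also have "\<dots> = 6 * s / real m" using s by simp
  also have "\<dots> = 6 * L\<^sup>2 * (sqrt (real m) / real m)" by (simp add: s_def)
  also have "sqrt (real m) / real m = 1 / sqrt (real m)"
    by (metis real_div_sqrt of_nat_0_le_iff inverse_eq_divide inverse_divide)
  finally show ?thesis by simp
qed

end

lemma inverse_sqrt_integral:
  fixes c :: real
  assumes c: "0 < c"
  shows "integrable lborel (\<lambda>v. indicator {0<..c} v * (v / c) powr (- (1/2)))"
    and "(LBINT v. indicator {0<..c} v * (v / c) powr (- (1/2))) = 2 * c"
proof -
  let ?f = "\<lambda>v::real. indicator {0<..c} v * (v / c) powr (- (1/2))"
  have "((\<lambda>v. v powr (- (1/2))) has_integral (c powr (- (1/2) + 1) / (- (1/2) + 1))) {0..c}"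
    using c by (intro has_integral_powr_from_0) auto
  then have "((\<lambda>v. c powr (1/2) * v powr (- (1/2))) has_integral (c powr (1/2) * (c powr (1/2) / (1/2)))) {0..c}"
    by (intro has_integral_mult_right) simp
  also have "c powr (1/2) * (c powr (1/2) / (1/2)) = 2 * c"
    using c by (simp flip: powr_add)
  finally have "((\<lambda>v. if v \<in> {0..c} then c powr (1/2) * v powr (- (1/2)) else 0) has_integral 2 * c) UNIV"
    by (subst has_integral_restrict_UNIV)
  moreover have "(\<lambda>v. if v \<in> {0..c} then c powr (1/2) * v powr (- (1/2)) else 0) = ?f"
    using c by (auto simp: fun_eq_iff indicator_def powr_divide powr_minus field_simps)
  ultimately have "(?f has_integral 2 * c) UNIV" by simp
  then have nn: "(\<integral>\<^sup>+v. ennreal (?f v) \<partial>lborel) = ennreal (2 * c)"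
    by (intro nn_integral_has_integral_lborel) auto
  then show "integrable lborel ?f"
    by (intro integrableI_nn_integral_finite[of _ _ "2 * c"]) auto
  show "integral\<^sup>L lborel ?f = 2 * c"
    using c nn by (subst integral_eq_nn_integral) auto
qed

context square_integrable
begin

text \<open>
  Here \<open>B = 3 + 3 ln m\<close> bounds \<open>q\<close> between the extreme cells. At distance \<open>v\<close> from the end of an
  extreme cell the bound exceeds \<open>B\<close> by \<open>3 ln x\<close> with \<open>x = 1/(m v)\<close>, and \<open>ln x \<le> 4 x powr (1/4)\<close>
  makes the square of this excess integrable, of the order \<open>1/m\<close>.
\<close>
lemma exponential_tail_residual:
  assumes m: "m \<ge> 2" and mono: "mono_on {0<..<1} q"
    and zero: "\<And>u. u \<notin> {0<..<1} \<Longrightarrow> q u = 0"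
    and bnd: "\<And>u. 0 < u \<Longrightarrow> u < 1 \<Longrightarrow> \<bar>q u\<bar> \<le> 3 + 3 * ln (1 / min u (1 - u))"
  shows "residual m q \<le> (56 * ln (real m))\<^sup>2 / real m"
proof -
  define B where "B = 3 + 3 * ln (real m)"
  define c where "c = 1 / real m"
  have m0: "0 < real m" using m by simp
  have c: "0 < c" "c \<le> 1 / 2" using m by (auto simp: c_def)
  have lm: "2 / 3 \<le> ln (real m)"
    using ln2_ge_two_thirds ln_mono[of 2 "real m"] m by linarith
  have B: "0 \<le> B" "B \<le> 15 / 2 * ln (real m)" using lm by (auto simp: B_def)
  \<comment> \<open>The dominating function of \<open>q\<^sup>2\<close> as a function of the distance to the end point; \<open>288 = 2 * (3 * 4)\<^sup>2\<close>.\<close>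
  define D where "D v = indicator {0<..c} v * (2 * B\<^sup>2) + 288 * (indicator {0<..c} v * (v / c) powr (- (1/2)))" for v :: real
  have D: "integrable lborel D" "integral\<^sup>L lborel D = (2 * B\<^sup>2 + 576) / real m"
  proof -
    have "integrable lborel (\<lambda>v. indicator {0<..c} v * (2 * B\<^sup>2))" using c by simp
    moreover have "integrable lborel (\<lambda>v. 288 * (indicator {0<..c} v * (v / c) powr (- (1/2))))"
      using inverse_sqrt_integral(1)[OF c(1)] by simp
    moreover have "(LBINT v. indicator {0<..c} v * (2 * B\<^sup>2)) = c * (2 * B\<^sup>2)" using c by simp
    moreover have "(LBINT v. 288 * (indicator {0<..c} v * (v / c) powr (- (1/2)))) = 288 * (2 * c)"
      using inverse_sqrt_integral(2)[OF c(1)] by (subst integral_mult_right_zero) simp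
    ultimately show "integrable lborel D" "integral\<^sup>L lborel D = (2 * B\<^sup>2 + 576) / real m"
      unfolding D_def[abs_def] by (simp_all only: Bochner_Integration.integrable_add
          Bochner_Integration.integral_add) (simp add: c_def add_divide_distrib)
  qed
  have D0: "0 \<le> D v" for v by (auto simp: D_def split: split_indicator)
  have dom: "(q u)\<^sup>2 \<le> D v" if u: "0 < u" "u < 1" and v: "v = min u (1 - u)" "v \<le> c" for u v
  proof -
    have v0: "0 < v" using u v by auto
    define x where "x = c / v"
    have x: "1 \<le> x" using v v0 by (simp add: x_def)
    have "1 / v = real m * x" using m0 by (simp add: x_def c_def)
    then have "ln (1 / v) = ln (real m) + ln x" using m0 x by (simp add: ln_mult)
    moreover have "ln x \<le> x powr (1/4) / (1/4)" using x by (intro ln_powr_bound) auto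
    ultimately have "\<bar>q u\<bar> \<le> B + 12 * x powr (1/4)"
      using bnd[OF u] v(1) by (simp add: B_def)
    then have "\<bar>q u\<bar>\<^sup>2 \<le> (B + 12 * x powr (1/4))\<^sup>2" by (intro power_mono) auto
    also have "\<dots> \<le> 2 * B\<^sup>2 + 2 * (12 * x powr (1/4))\<^sup>2"
      using zero_le_power2[of "B - 12 * x powr (1/4)"] by (simp add: power2_eq_square algebra_simps)
    also have "2 * (12 * x powr (1/4))\<^sup>2 = 288 * (v / c) powr (- (1/2))"
    proof -
      have "(x powr (1/4))\<^sup>2 = x powr (1/2)" by (simp add: power2_eq_square flip: powr_add)
      also have "\<dots> = (v / c) powr (- (1/2))"
        using v0 c by (simp add: x_def powr_minus_divide powr_divide)
      finally show ?thesis by (simp add: power_mult_distrib)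
    qed
    finally show ?thesis using v0 v by (simp add: D_def)
  qed
  have "residual m q \<le> 4 * B\<^sup>2 / real m + 2 * ((2 * B\<^sup>2 + 576) / real m)"
  proof (rule residual_le[OF _ mono])
    fix u assume u: "1 / real m \<le> u" "u \<le> 1 - 1 / real m"
    have p: "0 < 1 / real m" using m0 by simp
    have min: "1 / real m \<le> min u (1 - u)" using u by auto
    then have "0 < min u (1 - u)" using p by linarith
    moreover from this have "1 / min u (1 - u) \<le> real m"
      using min m0 by (simp only: pos_divide_le_eq) (simp add: mult.commute)
    ultimately have "1 / min u (1 - u) \<le> real m" "0 < min u (1 - u)" by blast+
    then have "ln (1 / min u (1 - u)) \<le> ln (real m)" by (intro ln_mono) auto
    moreover have "\<bar>q u\<bar> \<le> 3 + 3 * ln (1 / min u (1 - u))"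
      using u p by (intro bnd) linarith+
    ultimately show "\<bar>q u\<bar> \<le> B" by (simp add: B_def)
  next
    have int: "integrable lborel (\<lambda>u. indicator (cell m i) u *\<^sub>R (q u)\<^sup>2)" for i
      using set_integrable_sq[of "cell m i"] by (simp add: set_integrable_def)
    have "(LBINT u:cell m 1. (q u)\<^sup>2) \<le> integral\<^sup>L lborel D"
      unfolding set_lebesgue_integral_def
    proof (rule integral_mono[OF int D(1)])
      fix u show "indicator (cell m 1) u *\<^sub>R (q u)\<^sup>2 \<le> D u"
        using dom[of u u] c D0 by (auto simp: cell_def c_def split: split_indicator)
    qed
    then show "(LBINT u:cell m 1. (q u)\<^sup>2) \<le> (2 * B\<^sup>2 + 576) / real m" by (simp add: D(2))
    have "(LBINT u:cell m m. (q u)\<^sup>2) \<le> (LBINT u. D (1 + (-1) * u))"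
      unfolding set_lebesgue_integral_def
    proof (rule integral_mono[OF int])
      show "integrable lborel (\<lambda>u. D (1 + (-1) * u))"
        using D(1) by (intro lborel_integrable_real_affine) auto
      fix u
      show "indicator (cell m m) u *\<^sub>R (q u)\<^sup>2 \<le> D (1 + (-1) * u)"
      proof (cases "u \<in> cell m m \<and> u < 1")
        case True
        then have "1 - c < u" using m0 by (auto simp: cell_def c_def diff_divide_distrib)
        then show ?thesis using dom[of u "1 - u"] c True by (auto simp: min_def)
      next
        case False
        then have "u \<notin> cell m m \<or> q u = 0" using zero[of u] by auto
        then show ?thesis using D0 by (auto split: split_indicator)
      qed
    qed
    also have "\<dots> = integral\<^sup>L lborel D"
      using lborel_integral_real_affine[of "-1" D 1] by simp
    finally show "(LBINT u:cell m m. (q u)\<^sup>2) \<le> (2 * B\<^sup>2 + 576) / real m" by (simp add: D(2))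
  qed (use m B in auto)
  also have "\<dots> = (8 * B\<^sup>2 + 1152) / real m" by (simp add: add_divide_distrib)
  also have "\<dots> \<le> (56 * ln (real m))\<^sup>2 / real m"
  proof (intro divide_right_mono)
    \<comment> \<open>As \<open>ln m \<ge> 2/3\<close>, the left-hand side is at most \<open>(450 + 2592) * (ln m)\<^sup>2\<close>, and \<open>56\<^sup>2 = 3136\<close>.\<close>
    have "B\<^sup>2 \<le> (15 / 2 * ln (real m))\<^sup>2" using B by (intro power_mono) auto
    moreover have "(2 / 3)\<^sup>2 \<le> (ln (real m))\<^sup>2" using lm by (intro power_mono) auto
    ultimately show "8 * B\<^sup>2 + 1152 \<le> (56 * ln (real m))\<^sup>2"
      by (simp add: power_mult_distrib power_divide)
  qed simp
  finally show ?thesis .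
qed

end

section \<open>Comparison in all directions\<close>

text \<open>The tail bound \<open>exp (1 - t/3)\<close> equals \<open>v\<close> exactly at \<open>t = 3 + 3 ln (1/v)\<close>.\<close>
lemma (in cdf_distribution) unit_quantile_tail_bound:
  assumes up: "\<And>t. measure M {t<..} \<le> exp (1 - t / 3)" and lo: "\<And>t. measure M {..<-t} \<le> exp (1 - t / 3)"
    and u: "0 < u" "u < 1"
  shows "\<bar>unit_quantile M u\<bar> \<le> 3 + 3 * ln (1 / min u (1 - u))"
proof -
  define v where "v = min u (1 - u)"
  have v: "0 < v" "v \<le> u" "v \<le> 1 - u" using u by (auto simp: v_def)
  define t where "t = 3 + 3 * ln (1 / v)"
  have "1 - t / 3 = ln v" using v by (simp add: t_def ln_div field_simps)
  then have t: "exp (1 - t / 3) = v" using v by simp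
  have "cdf M t = 1 - measure M {t<..}"
  proof -
    have "measure M {t<..} = measure M (space M - {..t})" by (intro arg_cong[where f="measure M"]) auto
    also have "\<dots> = 1 - measure M {..t}" by (rule prob_compl) simp
    finally show ?thesis by (simp add: cdf_def)
  qed
  then have "u \<le> cdf M t" using up[of t] t v by linarith
  then have "unit_quantile M u \<le> t" using u by (simp add: unit_quantile_le_iff)
  moreover have "- t \<le> unit_quantile M u"
  proof (rule ccontr)
    assume "\<not> - t \<le> unit_quantile M u"
    then obtain s where s: "unit_quantile M u < - s" "- s < - t" using dense[of "unit_quantile M u" "- t"] by (metis minus_minus not_le)
    have "u \<le> cdf M (unit_quantile M u)" using u unit_quantile_le_iff by blast
    also have "\<dots> \<le> measure M {..<-s}" unfolding cdf_def using s by (intro finite_measure_mono) auto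
    also have "\<dots> \<le> exp (1 - s / 3)" by (rule lo)
    also have "\<dots> < exp (1 - t / 3)" using s by simp
    finally show False using t v by simp
  qed
  ultimately show ?thesis by (simp add: t_def v_def)
qed

text \<open>The closed interval in the definition of \<open>\<lambda>\<^sub>i\<close> differs from the cell by one point, and the two
  versions of the quantile differ on a null set inside \<open>[0, 1]\<close>.\<close>
lemma lam_eq_cell_mean:
  assumes "i \<in> {1..m}"
  shows "lam d m \<mu> \<theta> i = cell_mean m (unit_quantile (marginal d \<mu> \<theta>)) i"
proof -
  let ?a = "(real i - 1) / real m" and ?b = "real i / real m"
  have "0 \<le> ?a" "?b \<le> 1" using assms by auto
  then have "(LBINT u:{?a..?b}. quantile (marginal d \<mu> \<theta>) u) = (LBINT u:cell m i. unit_quantile (marginal d \<mu> \<theta>) u)"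
    unfolding set_lebesgue_integral_def
    by (intro integral_discrete_difference[of "{0, 1, ?a}"])
      (auto simp: cell_def unit_quantile_def split: split_indicator)
  then show ?thesis by (simp add: lam_def cell_mean_def)
qed

lemma W2_marginal_le:
  assumes m: "m \<ge> 1" and x: "\<And>i. i \<in> {1..m} \<Longrightarrow> x i \<in> space (Rd d)"
    and "real_distribution (marginal d \<mu> \<theta>)"
    and sq: "integrable (marginal d \<mu> \<theta>) (\<lambda>x. x\<^sup>2)"
  shows "W2 (marginal d (empirical d m x) \<theta>) (marginal d \<mu> \<theta>)
    \<le> sqrt (1 / real m * (\<Sum>i=1..m. (rearr m (\<lambda>j. ip d (x j) \<theta>) i - lam d m \<mu> \<theta> i)\<^sup>2))
      + sqrt (residual m (unit_quantile (marginal d \<mu> \<theta>)))"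
proof -
  let ?\<nu> = "marginal d \<mu> \<theta>" and ?U = "restrict_space lborel {0<..<1::real}"
  let ?q = "unit_quantile ?\<nu>" and ?T = "step m (rearr m (\<lambda>j. ip d (x j) \<theta>))"
  interpret cdf_distribution ?\<nu> using assms(3) by (simp add: cdf_distribution_def)
  interpret q: square_integrable ?q by (rule square_integrable_unit_quantile[OF sq])
  have "W2 (marginal d (empirical d m x) \<theta>) ?\<nu> = W2 (distr ?U borel ?T) (distr ?U borel ?q)"
    using marginal_empirical[OF m, of x d \<theta>] x by (simp add: distr_unit_quantile)
  also have "\<dots> \<le> sqrt (LINT u|?U. (?T u - ?q u)\<^sup>2)"
    by (intro W2_le_coupling measurable_restrict_space1) simp_all
  also have "(LINT u|?U. (?T u - ?q u)\<^sup>2) = (LBINT u:{0<..<1}. (?T u - ?q u)\<^sup>2)"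
    by (simp add: integral_restrict_space set_lebesgue_integral_def)
  also have "\<dots> = 1 / real m * (\<Sum>i=1..m. (rearr m (\<lambda>j. ip d (x j) \<theta>) i - cell_mean m ?q i)\<^sup>2) + residual m ?q"
    by (rule q.step_distance[OF m])
  also have "(\<Sum>i=1..m. (rearr m (\<lambda>j. ip d (x j) \<theta>) i - cell_mean m ?q i)\<^sup>2)
      = (\<Sum>i=1..m. (rearr m (\<lambda>j. ip d (x j) \<theta>) i - lam d m \<mu> \<theta> i)\<^sup>2)"
    by (intro sum.cong) (simp_all add: lam_eq_cell_mean)
  also have "sqrt (1 / real m * \<dots> + residual m ?q) \<le> sqrt (1 / real m * \<dots>) + sqrt (residual m ?q)"
    by (intro sqrt_add_le_add_sqrt) (auto simp: residual_def intro!: sum_nonneg divide_nonneg_nonneg set_integral_nonneg_sq)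
  finally show ?thesis .
qed

lemma isotropic_direction:
  assumes "prob_space M" and [measurable]: "X \<in> measurable M (Rd d)"
    and cen: "centred d M X" and iso: "isotropic d M X" and \<theta>: "\<theta> \<in> unit_sphere d"
  shows "integrable M (\<lambda>\<omega>. (ip d (X \<omega>) \<theta>)\<^sup>2)" and "(LINT \<omega>|M. (ip d (X \<omega>) \<theta>)\<^sup>2) = 1"
proof -
  interpret prob_space M by fact
  have comp[measurable]: "(\<lambda>\<omega>. X \<omega> k) \<in> borel_measurable M" if "k < d" for k
    using measurable_compose[OF assms(2), of "\<lambda>x. x k" borel] that by (simp add: Rd_def)
  have int: "integrable M (\<lambda>\<omega>. X \<omega> j * X \<omega> k)" if jk: "j < d" "k < d" for j k
  proof (rule Bochner_Integration.integrable_bound)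
    show "integrable M (\<lambda>\<omega>. (X \<omega> j)\<^sup>2 + (X \<omega> k)\<^sup>2)" using iso jk by (auto simp: isotropic_def)
    have "\<bar>a * b\<bar> \<le> a\<^sup>2 + b\<^sup>2" for a b :: real
    proof -
      have "2 * (\<bar>a\<bar> * \<bar>b\<bar>) \<le> a\<^sup>2 + b\<^sup>2"
        using zero_le_power2[of "\<bar>a\<bar> - \<bar>b\<bar>"] by (simp add: power2_diff)
      moreover have "0 \<le> \<bar>a\<bar> * \<bar>b\<bar>" by simp
      ultimately show ?thesis unfolding abs_mult by linarith
    qed
    then show "AE \<omega> in M. norm (X \<omega> j * X \<omega> k) \<le> norm ((X \<omega> j)\<^sup>2 + (X \<omega> k)\<^sup>2)" by simp
    show "(\<lambda>\<omega>. X \<omega> j * X \<omega> k) \<in> borel_measurable M" using jk by measurable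
  qed
  have cov: "(LINT \<omega>|M. X \<omega> j * X \<omega> k) = (if j = k then 1 else 0)" if "j < d" "k < d" for j k
    using iso cen that by (auto simp: isotropic_def centred_def covariance_def)
  have e: "(ip d (X \<omega>) \<theta>)\<^sup>2 = (\<Sum>j<d. \<Sum>k<d. (\<theta> j * \<theta> k) * (X \<omega> j * X \<omega> k))" for \<omega>
    by (simp add: ip_def power2_eq_square sum_product ac_simps)
  show "integrable M (\<lambda>\<omega>. (ip d (X \<omega>) \<theta>)\<^sup>2)"
    unfolding e using int by (intro Bochner_Integration.integrable_sum integrable_mult_right) auto
  have "(LINT \<omega>|M. (ip d (X \<omega>) \<theta>)\<^sup>2) = (\<Sum>j<d. \<Sum>k<d. (\<theta> j * \<theta> k) * (LINT \<omega>|M. X \<omega> j * X \<omega> k))"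
    unfolding e using int
    by (subst Bochner_Integration.integral_sum, force)+ simp
  also have "\<dots> = (\<Sum>j<d. \<Sum>k<d. if j = k then \<theta> j * \<theta> k else 0)"
    using cov by (intro sum.cong) auto
  also have "\<dots> = ip d \<theta> \<theta>" by (simp add: ip_def)
  also have "\<dots> = 1" using \<theta> by (simp add: unit_sphere_def)
  finally show "(LINT \<omega>|M. (ip d (X \<omega>) \<theta>)\<^sup>2) = 1" .
qed

lemma unit_sphere_nonempty: "d \<ge> 1 \<Longrightarrow> unit_sphere d \<noteq> {}"
proof -
  assume d: "d \<ge> 1"
  let ?e = "\<lambda>k\<in>{..<d}. if k = 0 then 1 else 0 :: real"
  have "ip d ?e ?e = (\<Sum>k<d. if k = 0 then 1 else 0)" unfolding ip_def by (intro sum.cong) auto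
  also have "\<dots> = 1" using d by simp
  finally have "?e \<in> unit_sphere d" by (simp add: unit_sphere_def)
  then show ?thesis by blast
qed

text \<open>One realisation of the sample: the points \<open>x i\<close> are the values of the independent copies.\<close>
locale isotropic_sample = prob_space M for M :: "'w measure" +
  fixes d m :: nat and X :: "'w \<Rightarrow> nat \<Rightarrow> real" and x :: "nat \<Rightarrow> nat \<Rightarrow> real"
  assumes d: "d \<ge> 1" and m: "m \<ge> 1" and X [measurable]: "X \<in> measurable M (Rd d)"
    and cen: "centred d M X" and iso: "isotropic d M X"
    and x: "\<And>i. i \<in> {1..m} \<Longrightarrow> x i \<in> space (Rd d)"
begin

abbreviation "\<mu> \<equiv> distr M (Rd d) X"

lemma marginal_law: "marginal d \<mu> \<theta> = distr M borel (\<lambda>\<omega>. ip d (X \<omega>) \<theta>)"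
  unfolding marginal_def by (subst distr_distr) (auto simp: comp_def)

lemma real_distribution_marginal: "real_distribution (marginal d \<mu> \<theta>)"
  unfolding marginal_law by (rule real_distribution_distr) simp

lemma integrable_marginal_iff:
  "g \<in> borel_measurable borel \<Longrightarrow> integrable (marginal d \<mu> \<theta>) g \<longleftrightarrow> integrable M (\<lambda>\<omega>. g (ip d (X \<omega>) \<theta>))"
  for g :: "real \<Rightarrow> real"
  unfolding marginal_law by (intro integrable_distr_eq) auto

lemma integral_marginal:
  "g \<in> borel_measurable borel \<Longrightarrow> (LINT t|marginal d \<mu> \<theta>. g t) = (LINT \<omega>|M. g (ip d (X \<omega>) \<theta>))"
  for g :: "real \<Rightarrow> real"
  unfolding marginal_law by (intro integral_distr) auto

lemma marginal_second_moment:
  assumes "\<theta> \<in> unit_sphere d"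
  shows "integrable (marginal d \<mu> \<theta>) (\<lambda>t. t\<^sup>2)" and "(LINT t|marginal d \<mu> \<theta>. t\<^sup>2) = 1"
  using isotropic_direction[OF prob_space_axioms X cen iso assms]
  by (simp_all add: integrable_marginal_iff integral_marginal)

lemma unit_quantile_marginal:
  assumes "\<theta> \<in> unit_sphere d"
  shows "square_integrable (unit_quantile (marginal d \<mu> \<theta>))" and "mono_on {0<..<1} (unit_quantile (marginal d \<mu> \<theta>))"
proof -
  interpret nu: cdf_distribution "marginal d \<mu> \<theta>"
    using real_distribution_marginal by (simp add: cdf_distribution_def)
  show "square_integrable (unit_quantile (marginal d \<mu> \<theta>))" "mono_on {0<..<1} (unit_quantile (marginal d \<mu> \<theta>))"
    using nu.square_integrable_unit_quantile[OF marginal_second_moment(1)[OF assms]] nu.mono_on_unit_quantile by auto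
qed

text \<open>
  A supremum in the reals bounds its members only if they are bounded. Sorting preserves
  \<open>\<Sum>\<^sub>i \<langle>x\<^sub>i, \<theta>\<rangle>\<^sup>2\<close>, which is at most \<open>\<Sum>\<^sub>i \<parallel>x\<^sub>i\<parallel>\<^sup>2\<close>, and the cell means contribute at most the
  variance 1.
\<close>
lemma deviation_bdd:
  "bdd_above ((\<lambda>\<theta>. sqrt (1 / real m * (\<Sum>i=1..m. (rearr m (\<lambda>j. ip d (x j) \<theta>) i - lam d m \<mu> \<theta> i)\<^sup>2)))
     ` unit_sphere d)"
proof (rule bdd_aboveI2)
  fix \<theta> assume \<theta>: "\<theta> \<in> unit_sphere d"
  let ?y = "\<lambda>j. ip d (x j) \<theta>" and ?\<nu> = "marginal d \<mu> \<theta>"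
  interpret nu: cdf_distribution ?\<nu> using real_distribution_marginal by (simp add: cdf_distribution_def)
  interpret q: square_integrable "unit_quantile ?\<nu>" by (rule unit_quantile_marginal[OF \<theta>])
  have "1 / real m * (\<Sum>i=1..m. (lam d m \<mu> \<theta> i)\<^sup>2) = 1 / real m * (\<Sum>i=1..m. (cell_mean m (unit_quantile ?\<nu>) i)\<^sup>2)"
    by (intro arg_cong2[where f="(*)"] sum.cong) (simp_all add: lam_eq_cell_mean)
  also have "\<dots> \<le> (LBINT u:{0<..<1}. (unit_quantile ?\<nu> u)\<^sup>2)" by (rule q.sum_cell_mean_le[OF m])
  also have "\<dots> = 1" using nu.integral_unit_quantile[of "\<lambda>t. t\<^sup>2"] marginal_second_moment(2)[OF \<theta>] by simp
  finally have lam: "1 / real m * (\<Sum>i=1..m. (lam d m \<mu> \<theta> i)\<^sup>2) \<le> 1" .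
  have "(\<Sum>i=1..m. (rearr m ?y i)\<^sup>2) = (\<Sum>i=1..m. (?y i)\<^sup>2)"
    using rearr_permutes[OF m, of "\<lambda>t. t\<^sup>2" ?y] .
  also have "\<dots> \<le> (\<Sum>i=1..m. ip d (x i) (x i))"
  proof (rule sum_mono)
    fix i
    have "ip d \<theta> \<theta> = 1" using \<theta> by (simp add: unit_sphere_def)
    then show "(?y i)\<^sup>2 \<le> ip d (x i) (x i)"
      using Cauchy_Schwarz_ineq_sum[of "x i" \<theta> "{..<d}"] by (simp add: ip_def power2_eq_square)
  qed
  finally have y: "(\<Sum>i=1..m. (rearr m ?y i)\<^sup>2) \<le> (\<Sum>i=1..m. ip d (x i) (x i))" .
  have "(a - b)\<^sup>2 \<le> 2 * a\<^sup>2 + 2 * b\<^sup>2" for a b :: real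
    using zero_le_power2[of "a + b"] by (simp add: power2_eq_square algebra_simps)
  then have "(\<Sum>i=1..m. (rearr m ?y i - lam d m \<mu> \<theta> i)\<^sup>2)
      \<le> (\<Sum>i=1..m. 2 * (rearr m ?y i)\<^sup>2 + 2 * (lam d m \<mu> \<theta> i)\<^sup>2)" by (intro sum_mono)
  also have "\<dots> = 2 * (\<Sum>i=1..m. (rearr m ?y i)\<^sup>2) + 2 * (\<Sum>i=1..m. (lam d m \<mu> \<theta> i)\<^sup>2)"
    by (simp add: sum.distrib sum_distrib_left)
  also have "\<dots> \<le> 2 * (\<Sum>i=1..m. ip d (x i) (x i)) + 2 * (\<Sum>i=1..m. (lam d m \<mu> \<theta> i)\<^sup>2)"
    using y by simp
  finally have "1 / real m * (\<Sum>i=1..m. (rearr m ?y i - lam d m \<mu> \<theta> i)\<^sup>2)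
      \<le> 1 / real m * (2 * (\<Sum>i=1..m. ip d (x i) (x i)) + 2 * (\<Sum>i=1..m. (lam d m \<mu> \<theta> i)\<^sup>2))"
    by (intro mult_left_mono) auto
  also have "\<dots> \<le> 1 / real m * (2 * (\<Sum>i=1..m. ip d (x i) (x i))) + 2"
    using lam by (simp add: distrib_left)
  finally show "sqrt (1 / real m * (\<Sum>i=1..m. (rearr m ?y i - lam d m \<mu> \<theta> i)\<^sup>2))
      \<le> sqrt (1 / real m * (2 * (\<Sum>i=1..m. ip d (x i) (x i))) + 2)"
    by (rule real_sqrt_le_mono)
qed

lemma SW2_le_deviation:
  assumes "\<And>\<theta>. \<theta> \<in> unit_sphere d \<Longrightarrow> sqrt (residual m (unit_quantile (marginal d \<mu> \<theta>))) \<le> e"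
  shows "SW2 d (empirical d m x) \<mu> - e \<le> deviation d m \<mu> x"
proof -
  have "SW2 d (empirical d m x) \<mu> \<le> deviation d m \<mu> x + e"
    unfolding SW2_def
  proof (rule cSUP_least[OF unit_sphere_nonempty[OF d]])
    fix \<theta> assume \<theta>: "\<theta> \<in> unit_sphere d"
    have "sqrt (1 / real m * (\<Sum>i=1..m. (rearr m (\<lambda>j. ip d (x j) \<theta>) i - lam d m \<mu> \<theta> i)\<^sup>2)) \<le> deviation d m \<mu> x"
      unfolding deviation_def by (rule cSUP_upper[OF \<theta> deviation_bdd])
    then show "W2 (marginal d (empirical d m x) \<theta>) (marginal d \<mu> \<theta>) \<le> deviation d m \<mu> x + e"
      using W2_marginal_le[OF m _ real_distribution_marginal marginal_second_moment(1)[OF \<theta>], of x] x assms[OF \<theta>]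
      by fastforce
  qed
  then show ?thesis by simp
qed

lemma SW2_le_deviation_L4:
  assumes L: "L \<ge> 1" and L4: "(SUP \<theta> \<in> unit_sphere d. L4_norm M (\<lambda>\<omega>. ip d (X \<omega>) \<theta>)) \<le> ennreal L"
  shows "SW2 d (empirical d m x) \<mu> - 3 * L / real m powr (1 / 4) \<le> deviation d m \<mu> x"
proof (rule SW2_le_deviation)
  fix \<theta> assume \<theta>: "\<theta> \<in> unit_sphere d"
  let ?\<nu> = "marginal d \<mu> \<theta>"
  interpret nu: cdf_distribution ?\<nu> using real_distribution_marginal by (simp add: cdf_distribution_def)
  interpret q: square_integrable "unit_quantile ?\<nu>" by (rule unit_quantile_marginal[OF \<theta>])
  have le: "L4_norm M (\<lambda>\<omega>. ip d (X \<omega>) \<theta>) \<le> ennreal L"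
    by (rule order_trans[OF SUP_upper[OF \<theta>] L4])
  then have int: "integrable M (\<lambda>\<omega>. \<bar>ip d (X \<omega>) \<theta>\<bar> ^ 4)"
    by (auto simp: L4_norm_def top_unique split: if_splits)
  then have "root 4 (LINT \<omega>|M. \<bar>ip d (X \<omega>) \<theta>\<bar> ^ 4) \<le> L"
    using le L by (simp add: L4_norm_def)
  then have "(root 4 (LINT \<omega>|M. \<bar>ip d (X \<omega>) \<theta>\<bar> ^ 4)) ^ 4 \<le> L ^ 4"
    by (intro power_mono real_root_ge_zero) simp_all
  then have le4: "(LINT \<omega>|M. (ip d (X \<omega>) \<theta>) ^ 4) \<le> L ^ 4"
    by (subst (asm) real_root_pow_pos2) simp_all
  have ind: "indicator {0<..<1} u * (unit_quantile ?\<nu> u) ^ 4 = (unit_quantile ?\<nu> u) ^ 4" for u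
    using nu.unit_quantile_power_vanish[of 4 u] by (auto split: split_indicator)
  have "residual m (unit_quantile ?\<nu>) \<le> 6 * L\<^sup>2 / sqrt (real m)"
  proof (rule q.fourth_moment_residual[OF m unit_quantile_marginal(2)[OF \<theta>] less_le_trans[OF zero_less_one L]])
    show "integrable lborel (\<lambda>u. (unit_quantile ?\<nu> u) ^ 4)"
      using nu.integrable_unit_quantile[of "\<lambda>t. t ^ 4"] int by (simp add: integrable_marginal_iff set_integrable_def ind)
    show "(LBINT u. (unit_quantile ?\<nu> u) ^ 4) \<le> L ^ 4"
      using nu.integral_unit_quantile[of "\<lambda>t. t ^ 4"] le4 by (simp add: integral_marginal set_lebesgue_integral_def ind)
  qed
  also have "\<dots> \<le> (3 * L / real m powr (1 / 4))\<^sup>2"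
  proof -
    have "(real m powr (1 / 4))\<^sup>2 = sqrt (real m)"
      using m by (simp add: power2_eq_square powr_half_sqrt flip: powr_add)
    then show ?thesis by (simp add: power_divide power_mult_distrib divide_right_mono)
  qed
  finally show "sqrt (residual m (unit_quantile ?\<nu>)) \<le> 3 * L / real m powr (1 / 4)"
    using L by (intro real_le_lsqrt) auto
qed

text \<open>The lower tail in direction \<open>\<theta>\<close> is the upper tail in direction \<open>- \<theta>\<close>.\<close>
lemma SW2_le_deviation_log_concave:
  assumes lc: "log_concave d M X" and m2: "m \<ge> 2"
  shows "SW2 d (empirical d m x) \<mu> - 56 * ln (real m) / sqrt (real m) \<le> deviation d m \<mu> x"
proof (rule SW2_le_deviation)
  fix \<theta> assume \<theta>: "\<theta> \<in> unit_sphere d"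
  let ?\<nu> = "marginal d \<mu> \<theta>"
  interpret nu: cdf_distribution ?\<nu> using real_distribution_marginal by (simp add: cdf_distribution_def)
  interpret q: square_integrable "unit_quantile ?\<nu>" by (rule unit_quantile_marginal[OF \<theta>])
  note iso\<theta> = isotropic_direction[OF prob_space_axioms X cen iso \<theta>]
  have up: "measure ?\<nu> {t<..} \<le> exp (1 - t / 3)" for t
  proof -
    have "measure ?\<nu> {t<..} = measure M {\<omega> \<in> space M. t < ip d (X \<omega>) \<theta>}"
      unfolding marginal_law by (subst measure_distr) (auto intro!: arg_cong[where f="measure M"])
    then show ?thesis
      using log_concave_exponential_tail[OF prob_space_axioms lc iso\<theta>(1)] iso\<theta>(2) by simp
  qed
  have neg: "ip d v (\<lambda>k. - \<theta> k) = - ip d v \<theta>" for v by (simp add: ip_def sum_negf)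
  have lo: "measure ?\<nu> {..<-t} \<le> exp (1 - t / 3)" for t
  proof -
    have "measure ?\<nu> {..<-t} = measure M {\<omega> \<in> space M. t < ip d (X \<omega>) (\<lambda>k. - \<theta> k)}"
      unfolding marginal_law neg by (subst measure_distr) (auto intro!: arg_cong[where f="measure M"])
    then show ?thesis
      using log_concave_exponential_tail[OF prob_space_axioms lc, of "\<lambda>k. - \<theta> k" t] iso\<theta> by (simp add: neg)
  qed
  have "residual m (unit_quantile ?\<nu>) \<le> (56 * ln (real m))\<^sup>2 / real m"
    by (rule q.exponential_tail_residual[OF m2 unit_quantile_marginal(2)[OF \<theta>] _ nu.unit_quantile_tail_bound[OF up lo]])
      (auto simp: unit_quantile_def)
  also have "\<dots> = (56 * ln (real m) / sqrt (real m))\<^sup>2" by (simp add: power_divide)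
  finally show "sqrt (residual m (unit_quantile ?\<nu>)) \<le> 56 * ln (real m) / sqrt (real m)"
    using m2 by (intro real_le_lsqrt) auto
qed

end

theorem lemma2p24:
  shows "\<exists>(c1 :: real \<Rightarrow> real) (c2 :: real).
    \<forall>(d::nat) (m::nat) (M :: outcome measure)
      (X :: outcome \<Rightarrow> nat \<Rightarrow> real) (Xs :: nat \<Rightarrow> outcome \<Rightarrow> nat \<Rightarrow> real).
      d \<ge> 1 \<and> m \<ge> 1 \<and> prob_space M \<and> X \<in> measurable M (Rd d) \<and>
      centred d M X \<and> isotropic d M X \<and> iid_copies d m M X Xs \<longrightarrow>
      (\<forall>L::real. L \<ge> 1 \<and>
         (SUP \<theta> \<in> unit_sphere d. L4_norm M (\<lambda>\<omega>. ip d (X \<omega>) \<theta>)) \<le> ennreal L \<longrightarrow>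
         (\<forall>\<omega> \<in> space M.
            deviation d m (distr M (Rd d) X) (\<lambda>i. Xs i \<omega>)
            \<ge> SW2 d (empirical d m (\<lambda>i. Xs i \<omega>)) (distr M (Rd d) X)
               - c1 L / real m powr (1 / 4))) \<and>
      (log_concave d M X \<and> m \<ge> 2 \<longrightarrow>
         (\<forall>\<omega> \<in> space M.
            deviation d m (distr M (Rd d) X) (\<lambda>i. Xs i \<omega>)
            \<ge> SW2 d (empirical d m (\<lambda>i. Xs i \<omega>)) (distr M (Rd d) X)
               - c2 * ln (real m) / sqrt (real m)))"
proof (intro exI[of _ "\<lambda>L. 3 * L"] exI[of _ 56] allI impI, elim conjE)
  fix d m :: nat and M :: "outcome measure" and X :: "outcome \<Rightarrow> nat \<Rightarrow> real"
    and Xs :: "nat \<Rightarrow> outcome \<Rightarrow> nat \<Rightarrow> real"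
  assume *: "1 \<le> d" "1 \<le> m" "prob_space M" "X \<in> measurable M (Rd d)"
    "centred d M X" "isotropic d M X" "iid_copies d m M X Xs"
  have sample: "isotropic_sample M d m X (\<lambda>i. Xs i \<omega>)" if "\<omega> \<in> space M" for \<omega>
  proof -
    interpret prob_space M by fact
    have "Xs i \<in> measurable M (Rd d)" if "i \<in> {1..m}" for i
      using *(7) that by (auto simp: iid_copies_def indep_vars_def)
    then have "Xs i \<omega> \<in> space (Rd d)" if "i \<in> {1..m}" for i
      using that \<open>\<omega> \<in> space M\<close> by (auto dest: measurable_space)
    then show ?thesis using * by unfold_locales auto
  qed
  show "(\<forall>L::real. L \<ge> 1 \<and>
         (SUP \<theta> \<in> unit_sphere d. L4_norm M (\<lambda>\<omega>. ip d (X \<omega>) \<theta>)) \<le> ennreal L \<longrightarrow>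
         (\<forall>\<omega> \<in> space M.
            deviation d m (distr M (Rd d) X) (\<lambda>i. Xs i \<omega>)
            \<ge> SW2 d (empirical d m (\<lambda>i. Xs i \<omega>)) (distr M (Rd d) X)
               - 3 * L / real m powr (1 / 4))) \<and>
      (log_concave d M X \<and> m \<ge> 2 \<longrightarrow>
         (\<forall>\<omega> \<in> space M.
            deviation d m (distr M (Rd d) X) (\<lambda>i. Xs i \<omega>)
            \<ge> SW2 d (empirical d m (\<lambda>i. Xs i \<omega>)) (distr M (Rd d) X)
               - 56 * ln (real m) / sqrt (real m)))"
    using isotropic_sample.SW2_le_deviation_L4[OF sample]
      isotropic_sample.SW2_le_deviation_log_concave[OF sample] by blast
qed

end
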